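(* Let $p$ and $q=\frac{p+1}{2}$ both be odd primes. Let $\tilde p$ be the maximal odd divisor of $p-1$ and write $p-1=2^{k+1}\tilde p$. Then $$4\,C_{\rm u}(p)=C_{\rm u}(p+1)+2\,\overline{C}_{\rm u}(2\tilde p+1),$$ $$2\,c_{\rm u}(p,z)=\frac{c_{\rm u}(p+1,z)}{1+z}+\overline{c}_{\rm u}(2\tilde p+1,z^{2^k}),$$ $$4\,C_{\rm d}(p)=C_{\rm d}(p+1)+2\,\overline{C}_{\rm u}(2\tilde p+1),$$ $$2\,c_{\rm d}(p,z)=\frac{c_{\rm d}(p+1,z)}{1+z}+\overline{c}_{\rm u}(2\tilde p+1,z^{2^k}).$$
   Context: All graphs are simple (no loops, no multiple edges or arcs). An undirected edge is identified with the pair of oppositely directed arcs, so undirected graphs are regarded as symmetric digraphs. A circulant of order $n$ is a digraph on the vertex set $\mathbb{Z}_n=\{0,1,\dots,n-1\}$ invariant under the cyclic permutation $v\mapsto v+1 \pmod n$; it is regular of some valency $r$ (each vertex has out-degree and in-degree $r$; for undirected graphs $r$ is the usual degree). $C_{\rm d}(n,r)$ and $C_{\rm u}(n,r)$ are the numbers of isomorphism classes of, respectively, directed circulants (i.e. all circulant digraphs, including the undirected ones) and undirected circulants of order $n$ and valency $r$. Put $C_{\rm d}(n)=\sum_r C_{\rm d}(n,r)$, $C_{\rm u}(n)=\sum_r C_{\rm u}(n,r)$, $c_{\rm d}(n,z)=\sum_{r\ge 0}C_{\rm d}(n,r)z^r$ and $c_{\rm u}(n,z)=\sum_{r\ge 0}C_{\rm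 u}(n,r)z^r$. The cycle index of the regular cyclic permutation group of order and degree $m$ is $\mathcal{I}_m(x_1,x_2,\dots)=\frac1m\sum_{r\mid m}\phi(r)x_r^{m/r}$, with $\phi$ Euler's totient function. The quantity $\overline{c}_{\rm u}(2\tilde p+1,z)$ is defined as follows: if $2\tilde p+1$ is prime, then $\overline{c}_{\rm u}(2\tilde p+1,z):=c_{\rm u}(2\tilde p+1,z)$; otherwise $\overline{c}_{\rm u}(2\tilde p+1,z)$ is the polynomial obtained from $\mathcal{I}_{\tilde p}(x_1,x_2,\dots)$ by substituting $x_r:=1+z^{2r}$ for $r=1,2,\dots$. Moreover $\overline{C}_{\rm u}(2\tilde p+1):=\overline{c}_{\rm u}(2\tilde p+1,1)$. *)

theory Defs
  imports
    "Graph_Theory.Pair_Digraph"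
    "Graph_Theory.Digraph_Isomorphism"
    "HOL-Computational_Algebra.Polynomial_Factorial"
    "HOL-Number_Theory.Totient"
begin

text \<open>
  Loops are excluded by \<open>pair_digraph\<close>, parallel arcs by the representation of arcs as
  ordered pairs.  \<open>pair_graph\<close> additionally requires the arc set to be symmetric.
\<close>

definition circulant :: "nat \<Rightarrow> nat pair_pre_digraph \<Rightarrow> bool" where
  "circulant n G \<longleftrightarrow> pair_digraph G \<and> pverts G = {..<n} \<and>
     (\<lambda>(u, v). ((u + 1) mod n, (v + 1) mod n)) ` parcs G = parcs G"

definition has_valency :: "nat pair_pre_digraph \<Rightarrow> nat \<Rightarrow> bool" where
  "has_valency G r \<longleftrightarrow>
     (\<forall>v\<in>pverts G. out_degree (with_proj G) v = r \<and> in_degree (with_proj G) v = r)"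

definition directed_circulants :: "nat \<Rightarrow> nat \<Rightarrow> nat pair_pre_digraph set" where
  "directed_circulants n r = {G. circulant n G \<and> has_valency G r}"

definition undirected_circulants :: "nat \<Rightarrow> nat \<Rightarrow> nat pair_pre_digraph set" where
  "undirected_circulants n r = {G. circulant n G \<and> pair_graph G \<and> has_valency G r}"

definition iso_rel :: "nat pair_pre_digraph set \<Rightarrow> nat pair_pre_digraph rel" where
  "iso_rel S = {(G, H). G \<in> S \<and> H \<in> S \<and> digraph_iso (with_proj G) (with_proj H)}"

definition Cd_val :: "nat \<Rightarrow> nat \<Rightarrow> nat" where
  "Cd_val n r = card (directed_circulants n r // iso_rel (directed_circulants n r))"

definition Cu_val :: "nat \<Rightarrow> nat \<Rightarrow> nat" where
  "Cu_val n r = card (undirected_circulants n r // iso_rel (undirected_circulants n r))"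

text \<open>
  For \<open>n > 0\<close> all terms with \<open>r \<ge> n\<close> vanish (\<open>Cd_val_eq_0\<close> and \<open>Cu_val_eq_0\<close> below),
  so the following sums over \<open>r < n\<close> are the sums over all \<open>r\<close>.
\<close>

definition Cd :: "nat \<Rightarrow> nat" where
  "Cd n = (\<Sum>r<n. Cd_val n r)"

definition Cu :: "nat \<Rightarrow> nat" where
  "Cu n = (\<Sum>r<n. Cu_val n r)"

definition cd_poly :: "nat \<Rightarrow> rat poly" where
  "cd_poly n = (\<Sum>r<n. monom (of_nat (Cd_val n r)) r)"

definition cu_poly :: "nat \<Rightarrow> rat poly" where
  "cu_poly n = (\<Sum>r<n. monom (of_nat (Cu_val n r)) r)"

lemma has_valency_less:
  assumes "n > 0" "circulant n G" "has_valency G r"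
  shows "r < n"
proof -
  interpret pair_digraph G
    using assms(2) by (simp add: circulant_def)
  have V: "pverts G = {..<n}"
    using assms(2) by (simp add: circulant_def)
  have "out_arcs (with_proj G) 0 \<subseteq> Pair 0 ` {1..<n}"
  proof
    fix e assume e: "e \<in> out_arcs (with_proj G) 0"
    obtain u v where uv: "e = (u, v)"
      by (cases e)
    have arc: "(u, v) \<in> parcs G" "u = 0"
      using e uv by auto
    have "v \<noteq> 0" "v < n"
      using no_loops'[OF arc(1)] in_arcsD2[OF arc(1)] arc(2) V by auto
    then show "e \<in> Pair 0 ` {1..<n}"
      using uv arc by auto
  qed
  then have "card (out_arcs (with_proj G) 0) \<le> card (Pair (0::nat) ` {1..<n})"
    by (intro card_mono) auto
  also have "\<dots> \<le> n - 1"
    using card_image_le[of "{1..<n}" "Pair (0::nat)"] by simp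
  also have "card (out_arcs (with_proj G) 0) = r"
    using assms V by (auto simp: has_valency_def out_degree_def)
  finally show ?thesis
    using assms(1) by linarith
qed

lemma Cd_val_eq_0:
  assumes "n > 0" "r \<ge> n"
  shows "Cd_val n r = 0"
proof -
  have "G \<notin> directed_circulants n r" for G
  proof
    assume "G \<in> directed_circulants n r"
    then have "circulant n G" "has_valency G r"
      unfolding directed_circulants_def by blast+
    from has_valency_less[OF assms(1) this] assms(2) show False
      by simp
  qed
  then have "directed_circulants n r = {}"
    by blast
  then show ?thesis
    unfolding Cd_val_def by simp
qed

lemma Cu_val_eq_0:
  assumes "n > 0" "r \<ge> n"
  shows "Cu_val n r = 0"
proof -
  have "G \<notin> undirected_circulants n r" for G
  proof
    assume "G \<in> undirected_circulants n r"
    then have "circulant n G" "has_valency G r"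
      unfolding undirected_circulants_def by blast+
    from has_valency_less[OF assms(1) this] assms(2) show False
      by simp
  qed
  then have "undirected_circulants n r = {}"
    by blast
  then show ?thesis
    unfolding Cu_val_def by simp
qed

text \<open>
  The cycle index of the regular cyclic group of order and degree \<open>m\<close>, as the map sending
  the values substituted for the indeterminates \<open>x\<^sub>1, x\<^sub>2, \<dots>\<close> to the resulting polynomial.
\<close>

definition cycle_index_cyclic :: "nat \<Rightarrow> (nat \<Rightarrow> rat poly) \<Rightarrow> rat poly" where
  "cycle_index_cyclic m x =
     smult (1 / of_nat m) (\<Sum>r | r dvd m. of_nat (totient r) * x r ^ (m div r))"

text \<open>Only used at odd arguments \<open>n = 2 * m + 1\<close>, so that \<open>(n - 1) div 2 = m\<close>.\<close>

definition cu_bar_poly :: "nat \<Rightarrow> rat poly" where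
  "cu_bar_poly n =
     (if prime n then cu_poly n
      else cycle_index_cyclic ((n - 1) div 2) (\<lambda>r. 1 + monom 1 (2 * r)))"

definition Cu_bar :: "nat \<Rightarrow> rat" where
  "Cu_bar n = poly (cu_bar_poly n) 1"

end

theory Submission
  imports "HOL-Number_Theory.Residue_Primitive_Roots" Defs
begin

text \<open>
  A circulant of order \<open>n\<close> is the Cayley digraph of its connection set \<open>S\<close>, the set of
  out-neighbours of \<open>0\<close>, and multiplying \<open>S\<close> by a unit modulo \<open>n\<close> gives an isomorphic circulant.
  For \<open>n = q\<close> and \<open>n = 2 * q\<close> with \<open>q\<close> an odd prime there are no other isomorphisms to account
  for: isomorphic circulants have connection sets that differ by a multiplier
  (\<open>cayley_iso_imp_multiplier_prime\<close>, \<open>cayley_iso_imp_multiplier_double_prime\<close>).  So the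
  isomorphism classes are the orbits of the unit group, which is cyclic of order \<open>q - 1\<close>, on
  subsets of \<open>{1..<n}\<close>; undirected circulants correspond to the subsets invariant under \<open>-1\<close>, the
  element of order two of that group.  Away from the point \<open>q\<close> of \<open>{1..<2 * q}\<close>, which all
  multipliers fix, the group acts freely.  Burnside's lemma weighted by cardinality then yields the
  enumerators as sums over divisors (\<open>cd_poly_formula\<close>, \<open>cu_poly_formula\<close>): for directed
  circulants

    \<open>(q - 1) * c(n, z) = e(z) * (\<Sum>r | r dvd q - 1. \<phi>(r) * (1 + z ^ r) ^ (n div q * ((q - 1) div r)))\<close>

  with \<open>e(z) = 1\<close> for \<open>n = q\<close> and \<open>e(z) = 1 + z\<close> for \<open>n = 2 * q\<close>.  For undirected ones
  \<open>q - 1\<close> is replaced by \<open>(q - 1) div 2\<close>, and \<open>z\<close> by \<open>z ^ 2\<close> except in \<open>e(z)\<close>.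

  Now let \<open>p + 1 = 2 * q\<close> with \<open>p\<close> and \<open>q\<close> both prime.  Since \<open>p - 1 = 2 * (q - 1)\<close>, the sums for
  \<open>p\<close> and for \<open>p + 1\<close> have the same summands, indexed by the divisors of \<open>2 * N\<close> and of \<open>N\<close>
  respectively, where \<open>N\<close> is \<open>q - 1\<close> or \<open>(q - 1) div 2\<close>.  The divisors of \<open>2 * N\<close> that do not
  divide \<open>N\<close> are the numbers \<open>2 ^ (j + 1) * s\<close>, where \<open>2 ^ j\<close> is the largest power of two in \<open>N\<close>
  and \<open>s\<close> divides the odd part of \<open>N\<close>, and their contribution is the enumerator \<open>cu_bar_poly\<close> at a
  power of \<open>z\<close> (\<open>double_enumerator_identity\<close>).

  The multiplier theorems rest on a conjugacy argument.  An isomorphism \<open>f\<close> between two circulants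
  pulls the rotation back to a second regular cycle in the automorphism group of the first one.  If
  this cycle can be conjugated, inside that automorphism group, to a power of the rotation, then
  \<open>f\<close> can be corrected by an automorphism to a map that is affine and hence yields a multiplier
  (\<open>cayley_iso_commuting_imp_multiplier\<close>).  Writing \<open>n = e * q\<close>, the conjugation is possible as
  soon as only rotations centralise the \<open>e\<close>-th power of the rotation; counting fixed cosets modulo
  \<open>q\<close> takes the place of Sylow's theorem (\<open>conjugate_into_prime_subgroup\<close>).  For \<open>n = q\<close> the
  condition always holds.  For \<open>n = 2 * q\<close> it fails only if the odd elements of \<open>S\<close> are either
  none or all of the odd residues; up to complementation the digraph then splits into two copies
  of a circulant of order \<open>q\<close>.
\<close>

section \<open>Orbits and fixed points of periodic maps\<close>

text \<open>
  Nonnegative powers suffice: where some positive power of \<open>h\<close> fixes \<open>x\<close>, this is the orbit of \<open>x\<close>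
  under the cyclic group generated by \<open>h\<close>.
\<close>

definition cyclic_orbit :: "('a \<Rightarrow> 'a) \<Rightarrow> 'a \<Rightarrow> 'a set" where
  "cyclic_orbit h x = range (\<lambda>i. (h ^^ i) x)"

lemma cyclic_orbit_self: "x \<in> cyclic_orbit h x"
  unfolding cyclic_orbit_def by (rule range_eqI[of _ _ 0]) simp

lemma funpow_mult_period: "(h ^^ m) x = x \<Longrightarrow> (h ^^ (m * k)) x = x"
  by (induction k) (simp_all add: funpow_add)

lemma cyclic_orbit_eq:
  assumes "m > 0" "(h ^^ m) x = x" "y \<in> cyclic_orbit h x"
  shows "cyclic_orbit h y = cyclic_orbit h x"
proof -
  obtain i where y: "y = (h ^^ i) x"
    using assms(3) by (auto simp: cyclic_orbit_def)
  have "i + i * (m - 1) = m * i"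
    using assms(1) by (cases m) auto
  then have x: "(h ^^ (i * (m - 1))) y = x"
    using funpow_mult_period[OF assms(2), of i] unfolding y
    by (metis funpow_add comp_apply add.commute)
  have 1: "(h ^^ k) y = (h ^^ (k + i)) x" for k
    by (simp add: y funpow_add)
  have 2: "(h ^^ k) x = (h ^^ (k + i * (m - 1))) y" for k
    using x by (simp add: funpow_add)
  show ?thesis
    unfolding cyclic_orbit_def using 1 2 by blast
qed

lemma cyclic_orbit_image:
  assumes "m > 0" "(h ^^ m) x = x"
  shows "cyclic_orbit h x = (\<lambda>i. (h ^^ i) x) ` {..<m}"
proof -
  have "(h ^^ i) x = (h ^^ (i mod m)) x" for i
    using funpow_mod_eq[OF assms(2), of i] by simp
  moreover have "i mod m \<in> {..<m}" for i
    using assms(1) by simp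
  ultimately show ?thesis
    unfolding cyclic_orbit_def by blast
qed

lemma funpow_inj_period:
  assumes "m > 0" "\<And>i. (h ^^ i) x = x \<longleftrightarrow> m dvd i"
  shows "inj_on (\<lambda>i. (h ^^ i) x) {..<m}"
proof -
  have p: "(h ^^ m) x = x" using assms(2) by simp
  have False if "i < j" "j < m" "(h ^^ i) x = (h ^^ j) x" for i j
  proof -
    have "(h ^^ (m - j + i)) x = (h ^^ (m - j + j)) x"
      using that(3) by (simp only: funpow_add comp_apply)
    then have "(h ^^ (m - j + i)) x = x"
      using that p by simp
    then have "m dvd (m - j + i)"
      using assms(2) by blast
    then show False
      using that by (auto dest!: dvd_imp_le)
  qed
  then show ?thesis
    unfolding inj_on_def by (metis lessThan_iff linorder_neqE_nat)
qed

lemma card_cyclic_orbit: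
  assumes "m > 0" "\<And>i. (h ^^ i) x = x \<longleftrightarrow> m dvd i"
  shows "card (cyclic_orbit h x) = m"
proof -
  have "(h ^^ m) x = x" using assms(2) by simp
  from cyclic_orbit_image[OF assms(1) this] show ?thesis
    using card_image[OF funpow_inj_period[OF assms]] by simp
qed

lemma funpow_closed: "(\<And>x. x \<in> X \<Longrightarrow> h x \<in> X) \<Longrightarrow> x \<in> X \<Longrightarrow> (h ^^ i) x \<in> X"
  by (induction i) auto

lemma cyclic_orbit_subset: "(\<And>x. x \<in> X \<Longrightarrow> h x \<in> X) \<Longrightarrow> x \<in> X \<Longrightarrow> cyclic_orbit h x \<subseteq> X"
  unfolding cyclic_orbit_def using funpow_closed[of X h x] by blast

text \<open>
  The points that move fall into orbits of size exactly \<open>q\<close>: the minimal period of such a point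
  divides the prime \<open>q\<close> and is not \<open>1\<close>.
\<close>

lemma card_fixed_points_cong:
  assumes "finite X" "prime q" "\<And>x. x \<in> X \<Longrightarrow> h x \<in> X" "\<And>x. x \<in> X \<Longrightarrow> (h ^^ q) x = x"
  shows "[card X = card {x \<in> X. h x = x}] (mod q)"
proof -
  define Y where "Y = {x \<in> X. h x \<noteq> x}"
  have q: "q > 0" using assms(2) by (simp add: prime_gt_0_nat)
  have Y: "h x \<in> Y" if "x \<in> Y" for x
  proof -
    have "h (h x) \<noteq> h x"
    proof
      assume e: "h (h x) = h x"
      have "(h ^^ Suc k) x = h x" for k
        by (induction k) (use e in auto)
      from this[of "q - 1"] q have "(h ^^ q) x = h x" by simp
      with assms(4) that show False by (simp add: Y_def)
    qed
    then show ?thesis using that assms(3) by (simp add: Y_def)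
  qed
  have per: "(h ^^ i) x = x \<longleftrightarrow> q dvd i" if "x \<in> Y" for x i
  proof
    assume "q dvd i"
    then show "(h ^^ i) x = x"
      using funpow_mult_period[of q h x] assms(4) that by (auto simp: Y_def elim!: dvdE)
  next
    assume i: "(h ^^ i) x = x"
    show "q dvd i"
    proof (rule ccontr)
      assume "\<not> q dvd i"
      then have "coprime i q"
        using assms(2) by (metis prime_imp_coprime coprime_commute)
      then obtain j where j: "[i * j = 1] (mod q)"
        using cong_solve_coprime_nat[of i q] by auto
      have "(h ^^ (i * j)) x = x"
        by (rule funpow_mult_period[OF i])
      moreover have "(h ^^ (i * j)) x = (h ^^ ((i * j) mod q)) x"
        using funpow_mod_eq[of q h x "i * j"] assms(4) that by (simp add: Y_def)
      moreover have "(i * j) mod q = 1"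
        using j prime_gt_1_nat[OF assms(2)] by (simp add: cong_def)
      ultimately show False using that by (simp add: Y_def)
    qed
  qed
  have U: "\<Union> (cyclic_orbit h ` Y) = Y"
    using cyclic_orbit_subset[of Y h] Y cyclic_orbit_self[of _ h] by blast
  have "q dvd card (\<Union> (cyclic_orbit h ` Y))"
  proof (rule dvd_partition)
    show "finite (\<Union> (cyclic_orbit h ` Y))"
      unfolding U using assms(1) by (simp add: Y_def)
    show "\<forall>c\<in>cyclic_orbit h ` Y. q dvd card c"
      using card_cyclic_orbit[OF q per] by auto
    show "\<forall>c1\<in>cyclic_orbit h ` Y. \<forall>c2\<in>cyclic_orbit h ` Y. c1 \<noteq> c2 \<longrightarrow> c1 \<inter> c2 = {}"
    proof (intro ballI impI)
      fix c1 c2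
      assume "c1 \<in> cyclic_orbit h ` Y" "c2 \<in> cyclic_orbit h ` Y" and ne: "c1 \<noteq> c2"
      then obtain x y where xy: "x \<in> Y" "y \<in> Y" "c1 = cyclic_orbit h x" "c2 = cyclic_orbit h y"
        by blast
      have "c1 = c2" if "z \<in> c1" "z \<in> c2" for z
        using cyclic_orbit_eq[of q h x z] cyclic_orbit_eq[of q h y z] q per xy that by simp
      with ne show "c1 \<inter> c2 = {}" by blast
    qed
  qed
  then have "q dvd card Y" by (simp only: U)
  moreover have "card X = card Y + card {x \<in> X. h x = x}"
  proof -
    have "X = Y \<union> {x \<in> X. h x = x}" "Y \<inter> {x \<in> X. h x = x} = {}"
      by (auto simp: Y_def)
    then show ?thesis
      using card_Un_disjoint[of Y "{x \<in> X. h x = x}"] assms(1) by (simp add: Y_def)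
  qed
  ultimately show ?thesis
    by (metis cong_add_rcancel_0_nat cong_0_iff)
qed

section \<open>Conjugation into a subgroup of prime order\<close>

context group
begin

lemma coset_mult_fixed_iff:
  assumes "subgroup H G" "x \<in> carrier G" "b \<in> carrier G"
  shows "(H #> x) #> b = H #> x \<longleftrightarrow> x \<otimes> b \<otimes> inv x \<in> H"
proof -
  have HG: "H \<subseteq> carrier G" using assms(1) by (rule subgroup.subset)
  have "(H #> x) #> b = H #> (x \<otimes> b)"
    using coset_mult_assoc[OF HG] assms by simp
  moreover have "H #> (x \<otimes> b) = H #> x \<longleftrightarrow> x \<otimes> b \<in> H #> x"
    using repr_independence[OF _ _ assms(1)] rcos_self[OF _ assms(1)] assms(2,3)
    by (metis m_closed)
  moreover have "x \<otimes> b \<in> H #> x \<longleftrightarrow> x \<otimes> b \<otimes> inv x \<in> H"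
    using subgroup.rcos_module[OF assms(1) is_group] assms(2,3) by simp
  ultimately show ?thesis by simp
qed

text \<open>
  The map \<open>x \<mapsto> x \<otimes> a \<otimes> inv x\<close> takes equal values on \<open>x\<close> and \<open>y\<close> precisely when they lie in the
  same left coset of the centraliser of \<open>a\<close>, so all its fibres have the size of the centraliser.
  In the application \<open>H\<close> is generated by \<open>a\<close> and the set on the left is the normaliser of \<open>H\<close>.
\<close>

lemma card_normalizer_eq:
  assumes "finite (carrier G)" "H \<subseteq> carrier G" "a \<in> carrier G"
  shows "card {x \<in> carrier G. x \<otimes> a \<otimes> inv x \<in> H} =
    card {x \<in> carrier G. x \<otimes> a = a \<otimes> x} *
    card ((\<lambda>x. x \<otimes> a \<otimes> inv x) ` {x \<in> carrier G. x \<otimes> a \<otimes> inv x \<in> H})"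
proof -
  define \<kappa> where "\<kappa> = (\<lambda>x. x \<otimes> a \<otimes> inv x)"
  define N where "N = {x \<in> carrier G. \<kappa> x \<in> H}"
  define C where "C = {x \<in> carrier G. x \<otimes> a = a \<otimes> x}"
  have fin: "finite N" using assms(1) by (simp add: N_def)
  have fib: "card {x \<in> N. \<kappa> x = w} = card C" if w: "w \<in> \<kappa> ` N" for w
  proof -
    obtain y where y: "y \<in> carrier G" "\<kappa> y \<in> H" "w = \<kappa> y"
      using w by (auto simp: N_def)
    have eq: "\<kappa> (y \<otimes> c) = \<kappa> y \<longleftrightarrow> c \<otimes> a = a \<otimes> c" if c: "c \<in> carrier G" for c
    proof -
      have "\<kappa> (y \<otimes> c) = y \<otimes> (c \<otimes> a \<otimes> inv c) \<otimes> inv y"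
        using y(1) c assms(3) by (simp add: \<kappa>_def inv_mult_group m_assoc)
      also have "\<dots> = \<kappa> y \<longleftrightarrow> c \<otimes> a \<otimes> inv c = a"
        using y(1) c assms(3) by (simp add: \<kappa>_def)
      also have "\<dots> \<longleftrightarrow> c \<otimes> a = a \<otimes> c"
        using c assms(3) by (metis inv_solve_right m_closed)
      finally show ?thesis .
    qed
    have "bij_betw (\<lambda>c. y \<otimes> c) C {x \<in> N. \<kappa> x = w}"
    proof (rule bij_betwI[where g = "\<lambda>x. inv y \<otimes> x"])
      show "(\<lambda>c. y \<otimes> c) \<in> C \<rightarrow> {x \<in> N. \<kappa> x = w}"
      proof
        fix c assume "c \<in> C"
        then have "c \<in> carrier G" "\<kappa> (y \<otimes> c) = \<kappa> y" using eq by (auto simp: C_def)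
        then show "y \<otimes> c \<in> {x \<in> N. \<kappa> x = w}" using y by (simp add: N_def)
      qed
      show "(\<lambda>x. inv y \<otimes> x) \<in> {x \<in> N. \<kappa> x = w} \<rightarrow> C"
      proof
        fix x assume x: "x \<in> {x \<in> N. \<kappa> x = w}"
        then have xc: "x \<in> carrier G" by (simp add: N_def)
        have "y \<otimes> (inv y \<otimes> x) = x"
          using xc y(1) by (simp add: m_assoc[symmetric])
        then show "inv y \<otimes> x \<in> C"
          using eq[of "inv y \<otimes> x"] x xc y by (simp add: C_def)
      qed
    qed (use y(1) in \<open>auto simp: C_def N_def m_assoc[symmetric]\<close>)
    then show ?thesis by (simp add: bij_betw_same_card)
  qed
  have "card N = (\<Sum>x\<in>N. 1)" by simp
  also have "\<dots> = (\<Sum>w\<in>\<kappa> ` N. \<Sum>x\<in>{x. x \<in> N \<and> \<kappa> x = w}. 1)"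
    by (rule sum.image_gen[OF fin])
  also have "\<dots> = (\<Sum>w\<in>\<kappa> ` N. card C)"
    using fib by (intro sum.cong) auto
  finally show ?thesis
    by (simp add: N_def C_def \<kappa>_def)
qed

text \<open>
  A substitute for Sylow's conjugacy theorem whose hypothesis concerns only the centraliser of
  \<open>a\<close>.  Elements whose \<open>q\<close>-th power is trivial act on the cosets of \<open>H\<close>, and modulo \<open>q\<close> each of
  them fixes as many cosets as there are cosets.  For \<open>a\<close> the fixed cosets make up the normaliser of
  \<open>H\<close>, so their number is \<open>c\<close> times the number of conjugates of \<open>a\<close> in \<open>H\<close>; the latter is between
  \<open>1\<close> and \<open>q - 1\<close>, so the product is prime to \<open>q\<close>.  Hence \<open>b\<close> fixes some coset \<open>H #> g\<close> as well,
  which means that \<open>g\<close> conjugates \<open>b\<close> into \<open>H\<close>.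
\<close>

lemma conjugate_into_prime_subgroup:
  assumes fin: "finite (carrier G)" and H: "subgroup H G" "card H = q" and q: "prime q"
    and a: "a \<in> H" "a \<noteq> \<one>"
    and C: "card {x \<in> carrier G. x \<otimes> a = a \<otimes> x} = q * c" "\<not> q dvd c"
    and b: "b \<in> carrier G" "b [^] q = \<one>"
  shows "\<exists>g\<in>carrier G. g \<otimes> b \<otimes> inv g \<in> H"
proof -
  have HG: "H \<subseteq> carrier G" using H(1) by (rule subgroup.subset)
  have ac: "a \<in> carrier G" using a HG by blast
  have finH: "finite H" using HG fin by (rule finite_subset)
  have finR: "finite (rcosets H)"
    unfolding RCOSETS_def using fin by simp
  have rep: "\<exists>x\<in>carrier G. K = H #> x" if "K \<in> rcosets H" for K
    using that by (auto simp: RCOSETS_def)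
  have closed: "K #> y \<in> rcosets H" if "K \<in> rcosets H" "y \<in> carrier G" for K y
    using rep[OF that(1)] coset_mult_assoc[OF HG] rcosetsI[OF HG] that(2) by force
  have powr: "((\<lambda>K. K #> y) ^^ k) K = K #> (y [^] k)"
    if "K \<in> rcosets H" "y \<in> carrier G" for K y and k :: nat
  proof (induction k)
    case 0
    show ?case using rep[OF that(1)] coset_mult_one r_coset_subset_G[OF HG] by force
  next
    case (Suc k)
    have "K \<subseteq> carrier G" using rep[OF that(1)] r_coset_subset_G[OF HG] by force
    then show ?case using Suc that(2) by (simp add: coset_mult_assoc)
  qed
  have aq: "a [^] q = \<one>"
  proof -
    interpret HG: group "G\<lparr>carrier := H\<rparr>"
      using H(1) by (rule subgroup.subgroup_is_group[OF _ is_group])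
    have "a [^]\<^bsub>G\<lparr>carrier := H\<rparr>\<^esub> Coset.order (G\<lparr>carrier := H\<rparr>) = \<one>\<^bsub>G\<lparr>carrier := H\<rparr>\<^esub>"
      by (rule HG.pow_order_eq_1) (use a finH in auto)
    then show ?thesis
      using H(2) by (simp add: Coset.order_def nat_pow_consistent[symmetric])
  qed
  have cong: "[card (rcosets H) = card {K \<in> rcosets H. K #> y = K}] (mod q)"
    if "y \<in> carrier G" "y [^] q = \<one>" for y
  proof (rule card_fixed_points_cong[OF finR q])
    show "((\<lambda>K. K #> y) ^^ q) K = K" if K: "K \<in> rcosets H" for K
      using powr[OF K \<open>y \<in> carrier G\<close>, of q] \<open>y [^] q = \<one>\<close>
        powr[OF K \<open>y \<in> carrier G\<close>, of 0] by simp
  qed (use closed that in auto)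
  define N where "N = {x \<in> carrier G. x \<otimes> a \<otimes> inv x \<in> H}"
  define F where "F = {K \<in> rcosets H. K #> a = K}"
  have UF: "\<Union>F = N"
  proof
    show "\<Union>F \<subseteq> N"
    proof
      fix y assume "y \<in> \<Union>F"
      then obtain K where K: "K \<in> F" "y \<in> K" by blast
      obtain x where x: "x \<in> carrier G" "K = H #> x"
        using rep K(1) unfolding F_def by blast
      have y: "y \<in> carrier G" using K(2) x r_coset_subset_G[OF HG] by blast
      have "K = H #> y" using repr_independence[OF _ x(1) H(1)] K(2) x(2) by simp
      then show "y \<in> N"
        using K(1) coset_mult_fixed_iff[OF H(1) y ac] y by (simp add: N_def F_def)
    qed
    show "N \<subseteq> \<Union>F"
    proof
      fix y assume "y \<in> N"
      then have "H #> y \<in> F" "y \<in> H #> y"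
        using coset_mult_fixed_iff[OF H(1) _ ac] rcosetsI[OF HG] rcos_self[OF _ H(1)]
        by (auto simp: N_def F_def)
      then show "y \<in> \<Union>F" by blast
    qed
  qed
  have finF: "finite F" using finR by (simp add: F_def)
  have cN: "q * card F = card N"
    unfolding UF[symmetric]
  proof (rule card_partition[OF finF])
    show "finite (\<Union>F)" unfolding UF using fin by (simp add: N_def)
    show "card K = q" if "K \<in> F" for K
      using that card_rcosets_equal[OF _ HG, of K] H(2) by (simp add: F_def)
    show "K \<inter> L = {}" if "K \<in> F" "L \<in> F" "K \<noteq> L" for K L
      using rcos_disjoint[OF H(1)] that by (auto simp: F_def pairwise_def disjnt_def)
  qed
  define I where "I = (\<lambda>x. x \<otimes> a \<otimes> inv x) ` N"
  have "card N = q * c * card I"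
    using card_normalizer_eq[OF fin HG ac] C(1) by (simp add: N_def I_def)
  then have "card F = c * card I"
    using cN prime_gt_0_nat[OF q] by simp
  moreover have "\<not> q dvd card I"
  proof
    assume d: "q dvd card I"
    have "\<one> \<in> N" using a ac by (simp add: N_def)
    then have "I \<noteq> {}" by (auto simp: I_def)
    have "I \<subseteq> H - {\<one>}"
    proof
      fix w assume "w \<in> I"
      then obtain x where x: "x \<in> N" "w = x \<otimes> a \<otimes> inv x" by (auto simp: I_def)
      have "w \<noteq> \<one>"
      proof
        assume "w = \<one>"
        then have "x \<otimes> a = x"
          using x ac by (metis (no_types, lifting) N_def inv_solve_right' l_one m_closed
              mem_Collect_eq one_closed)
        then show False using a x ac by (simp add: N_def)
      qed
      then show "w \<in> H - {\<one>}" using x by (simp add: N_def)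
    qed
    moreover have "\<one> \<in> H" using H(1) by (rule subgroup.one_closed)
    ultimately have "card I < card H"
      using finH by (intro psubset_card_mono) auto
    moreover have "card I > 0"
      using \<open>I \<noteq> {}\<close> \<open>I \<subseteq> H - {\<one>}\<close> finH by (metis card_gt_0_iff finite_Diff finite_subset)
    ultimately show False using d H(2) by (auto dest: dvd_imp_le)
  qed
  ultimately have "\<not> q dvd card F"
    using C(2) q by (simp add: prime_dvd_mult_iff)
  moreover have "[card {K \<in> rcosets H. K #> b = K} = card F] (mod q)"
    unfolding F_def by (rule cong_trans[OF cong_sym[OF cong[OF b]] cong[OF ac aq]])
  ultimately have "card {K \<in> rcosets H. K #> b = K} \<noteq> 0"
    by (metis cong_0_iff cong_sym)
  then have "{K \<in> rcosets H. K #> b = K} \<noteq> {}" by (metis card.empty)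
  then obtain K where K: "K \<in> rcosets H" "K #> b = K" by blast
  obtain x where x: "x \<in> carrier G" "K = H #> x" using rep[OF K(1)] by auto
  have "x \<otimes> b \<otimes> inv x \<in> H"
    using coset_mult_fixed_iff[OF H(1) x(1) b(1)] K(2) x(2) by simp
  with x(1) show ?thesis by (rule bexI[rotated])
qed

end

section \<open>Cayley digraphs of cyclic groups and their isomorphisms\<close>

abbreviation perm_inv :: "('a \<Rightarrow> 'a) \<Rightarrow> 'a \<Rightarrow> 'a" where
  "perm_inv f \<equiv> inv_into UNIV f"

text \<open>
  Permutations of \<open>{..<n}\<close> are represented by functions that are the identity elsewhere, so that
  composition, inverse and powers of functions are those of the symmetric group.
\<close>

definition rotation :: "nat \<Rightarrow> nat \<Rightarrow> nat" where
  "rotation n v = (if v < n then (v + 1) mod n else v)"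

definition cayley :: "nat \<Rightarrow> nat set \<Rightarrow> (nat \<times> nat) set" where
  "cayley n S = {(u, (u + s) mod n) | u s. u < n \<and> s \<in> S}"

definition cayley_iso :: "nat \<Rightarrow> nat set \<Rightarrow> nat set \<Rightarrow> (nat \<Rightarrow> nat) \<Rightarrow> bool" where
  "cayley_iso n S T f \<longleftrightarrow> f permutes {..<n} \<and>
     (\<forall>u<n. \<forall>v<n. (u, v) \<in> cayley n S \<longleftrightarrow> (f u, f v) \<in> cayley n T)"

definition cayley_aut :: "nat \<Rightarrow> nat set \<Rightarrow> (nat \<Rightarrow> nat) monoid" where
  "cayley_aut n S = \<lparr>carrier = {f. cayley_iso n S S f}, monoid.mult = (\<circ>), one = id\<rparr>"

lemma add_mod_cancel_left:
  fixes u s t n :: nat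
  assumes "s < n" "t < n" "(u + s) mod n = (u + t) mod n"
  shows "s = t"
  using assms by (metis cong_add_lcancel_nat cong_def mod_less)

lemma cayley_iff:
  assumes "S \<subseteq> {..<n}" "u < n" "s < n"
  shows "(u, (u + s) mod n) \<in> cayley n S \<longleftrightarrow> s \<in> S"
  using assms add_mod_cancel_left[of s n] by (fastforce simp: cayley_def)

lemma difference_exists:
  fixes u v n :: nat
  assumes "u < n" "v < n"
  obtains s where "s < n" "v = (u + s) mod n"
proof
  show "(v + (n - u)) mod n < n" using assms by simp
  have "u + (v + (n - u)) = v + n" using assms by simp
  then show "v = (u + (v + (n - u)) mod n) mod n"
    using assms by (simp add: mod_add_right_eq)
qed

lemma rotation_lt: "v < n \<Longrightarrow> rotation n v < n"
  by (simp add: rotation_def)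

lemma rotation_funpow: "v < n \<Longrightarrow> (rotation n ^^ k) v = (v + k) mod n"
  by (induction k) (auto simp: rotation_def mod_simps)

lemma rotation_funpow_outside: "\<not> v < n \<Longrightarrow> (rotation n ^^ k) v = v"
  by (induction k) (auto simp: rotation_def)

lemma rotation_funpow_eq_iff:
  assumes "n > 0"
  shows "rotation n ^^ j = rotation n ^^ k \<longleftrightarrow> [j = k] (mod n)"
proof
  assume "rotation n ^^ j = rotation n ^^ k"
  from fun_cong[OF this, of 0] show "[j = k] (mod n)"
    using assms by (simp add: rotation_funpow cong_def)
next
  assume c: "[j = k] (mod n)"
  show "rotation n ^^ j = rotation n ^^ k"
  proof
    fix v show "(rotation n ^^ j) v = (rotation n ^^ k) v"
    proof (cases "v < n")
      case True
      then show ?thesis using c cong_add[of v v n j k]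
        by (simp add: rotation_funpow cong_def)
    qed (simp add: rotation_funpow_outside)
  qed
qed

lemma rotation_funpow_eq_id_iff: "n > 0 \<Longrightarrow> rotation n ^^ k = id \<longleftrightarrow> n dvd k"
  using rotation_funpow_eq_iff[of n k 0] by (simp add: cong_0_iff)

lemma rotation_permutes: "rotation n permutes {..<n}"
proof (cases "n = 0")
  case False
  have "rotation n ^^ n = id"
    using rotation_funpow_eq_id_iff[of n n] False by simp
  then have "rotation n \<circ> rotation n ^^ (n - 1) = id" "rotation n ^^ (n - 1) \<circ> rotation n = id"
    using False by (metis Suc_diff_1 funpow.simps(2) neq0_conv,
        metis Suc_diff_1 funpow_Suc_right neq0_conv)
  then have "bij (rotation n)" by (rule o_bij[rotated])
  then show ?thesis by (simp add: permutes_def bij_iff rotation_def)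
qed (auto simp: rotation_def permutes_def)

lemma cayley_iso_permutes: "cayley_iso n S T f \<Longrightarrow> f permutes {..<n}"
  by (simp add: cayley_iso_def)

lemma cayley_iso_lt: "cayley_iso n S T f \<Longrightarrow> u < n \<Longrightarrow> f u < n"
  using permutes_in_image[of f "{..<n}" u] by (simp add: cayley_iso_def)

lemma cayley_isoD:
  "cayley_iso n S T f \<Longrightarrow> u < n \<Longrightarrow> v < n \<Longrightarrow> (u, v) \<in> cayley n S \<longleftrightarrow> (f u, f v) \<in> cayley n T"
  by (simp add: cayley_iso_def)

lemma cayley_iso_id: "cayley_iso n S S id"
  by (simp add: cayley_iso_def permutes_id)

lemma cayley_iso_comp:
  assumes "cayley_iso n S T f" "cayley_iso n T U g"
  shows "cayley_iso n S U (g \<circ> f)"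
  unfolding cayley_iso_def
  using cayley_isoD[OF assms(1)] cayley_isoD[OF assms(2)] cayley_iso_lt[OF assms(1)]
    permutes_compose[OF cayley_iso_permutes[OF assms(1)] cayley_iso_permutes[OF assms(2)]]
  by simp

lemma cayley_iso_inv:
  assumes "cayley_iso n S T f"
  shows "cayley_iso n T S (perm_inv f)"
proof -
  have p: "f permutes {..<n}" using assms by (rule cayley_iso_permutes)
  have ip: "perm_inv f permutes {..<n}" by (rule permutes_inv[OF p])
  have "perm_inv f u < n" if "u < n" for u
    using permutes_in_image[OF ip, of u] that by simp
  moreover have "f (perm_inv f u) = u" for u
    using permutes_inverses(1)[OF p] .
  ultimately show ?thesis
    using cayley_isoD[OF assms] ip unfolding cayley_iso_def by metis
qed

lemma cayley_iso_rotation: "S \<subseteq> {..<n} \<Longrightarrow> cayley_iso n S S (rotation n)"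
  unfolding cayley_iso_def
proof (intro conjI allI impI)
  fix u v assume S: "S \<subseteq> {..<n}" and uv: "u < n" "v < n"
  obtain s where s: "s < n" "v = (u + s) mod n"
    using difference_exists uv by blast
  have "rotation n v = (rotation n u + s) mod n"
    using uv s by (simp add: rotation_def mod_simps)
  then show "(u, v) \<in> cayley n S \<longleftrightarrow> (rotation n u, rotation n v) \<in> cayley n S"
    using cayley_iff[OF S uv(1) s(1)] cayley_iff[OF S rotation_lt[OF uv(1)] s(1)] s(2) by simp
qed (rule rotation_permutes)

lemma cayley_iso_funpow: "cayley_iso n S S f \<Longrightarrow> cayley_iso n S S (f ^^ k)"
proof (induction k)
  case (Suc k)
  then show ?case using cayley_iso_comp[OF Suc.IH Suc.prems] by (simp only: funpow.simps)
qed (simp only: cayley_iso_id funpow.simps)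

lemma cayley_aut_simps [simp]:
  "carrier (cayley_aut n S) = {f. cayley_iso n S S f}"
  "x \<otimes>\<^bsub>cayley_aut n S\<^esub> y = x \<circ> y" "\<one>\<^bsub>cayley_aut n S\<^esub> = id"
  by (simp_all add: cayley_aut_def)

lemma permutes_inv_comp: "f permutes A \<Longrightarrow> perm_inv f \<circ> f = id" "f permutes A \<Longrightarrow> f \<circ> perm_inv f = id"
  by (simp_all add: permutes_inv_o)

lemma group_cayley_aut: "group (cayley_aut n S)"
proof (rule groupI)
  fix x assume "x \<in> carrier (cayley_aut n S)"
  then show "\<exists>y\<in>carrier (cayley_aut n S). y \<otimes>\<^bsub>cayley_aut n S\<^esub> x = \<one>\<^bsub>cayley_aut n S\<^esub>"
    using cayley_iso_inv[of n S S x] permutes_inv_comp(1)[OF cayley_iso_permutes, of n S S x]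
    by (intro bexI[of _ "perm_inv x"]) (simp_all del: fun_eq_iff)
qed (auto intro: cayley_iso_comp cayley_iso_id simp: comp_assoc)

lemma inv_cayley_aut:
  assumes "cayley_iso n S S f"
  shows "inv\<^bsub>cayley_aut n S\<^esub> f = perm_inv f"
proof -
  interpret group "cayley_aut n S" by (rule group_cayley_aut)
  show ?thesis
    by (rule inv_equality)
      (use assms cayley_iso_inv[OF assms] permutes_inv_comp(1)[OF cayley_iso_permutes[OF assms]] in auto)
qed

lemma pow_cayley_aut: "f [^]\<^bsub>cayley_aut n S\<^esub> (k::nat) = f ^^ k"
proof -
  interpret group "cayley_aut n S" by (rule group_cayley_aut)
  show ?thesis by (induction k) (simp_all add: funpow_Suc_right del: funpow.simps)
qed

lemma finite_cayley_aut: "finite (carrier (cayley_aut n S))"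
proof (rule finite_subset)
  show "carrier (cayley_aut n S) \<subseteq> {f. f permutes {..<n}}"
    by (auto simp: cayley_iso_def)
  show "finite {f. f permutes {..<n}}" by (rule finite_permutations) simp
qed

lemma funpow_conjugate:
  assumes "g \<circ> g' = id" "g' \<circ> g = id"
  shows "(g' \<circ> b \<circ> g) ^^ k = g' \<circ> b ^^ k \<circ> g"
proof (induction k)
  case 0
  show ?case by (simp only: funpow.simps comp_id assms)
next
  case (Suc k)
  have "(g' \<circ> b \<circ> g) ^^ Suc k = (g' \<circ> b \<circ> g) \<circ> (g' \<circ> b ^^ k \<circ> g)"
    by (simp only: Suc funpow.simps)
  also have "\<dots> = g' \<circ> b \<circ> (g \<circ> g') \<circ> b ^^ k \<circ> g"
    by (simp only: comp_assoc)
  also have "\<dots> = g' \<circ> b ^^ Suc k \<circ> g"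
    by (simp only: assms comp_id funpow.simps comp_assoc)
  finally show ?case .
qed

text \<open>
  From \<open>h \<circ> rotation n ^^ k = rotation n \<circ> h\<close> one gets \<open>h (k * t) = h 0 + t\<close> modulo \<open>n\<close>.  As \<open>h\<close> is
  injective, the \<open>t\<close> with \<open>h 1 = h 0 + t\<close> is an inverse of \<open>k\<close>, and it is the multiplier sought.
\<close>

lemma cayley_iso_commuting_imp_multiplier:
  assumes n: "n > 1" and S: "S \<subseteq> {..<n}" and T: "T \<subseteq> {..<n}"
    and h: "cayley_iso n S T h" and comm: "h \<circ> rotation n ^^ k = rotation n \<circ> h"
  shows "\<exists>u. coprime u n \<and> T = (\<lambda>s. u * s mod n) ` S"
proof -
  have pw: "h \<circ> rotation n ^^ (k * t) = rotation n ^^ t \<circ> h" for t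
  proof (induction t)
    case (Suc t)
    have "h \<circ> rotation n ^^ (k * Suc t) = (h \<circ> rotation n ^^ k) \<circ> rotation n ^^ (k * t)"
      by (simp add: funpow_add comp_assoc)
    also have "\<dots> = rotation n \<circ> (h \<circ> rotation n ^^ (k * t))"
      by (simp only: comm comp_assoc)
    also have "\<dots> = rotation n ^^ Suc t \<circ> h"
      by (simp only: Suc funpow.simps comp_assoc)
    finally show ?case .
  qed simp
  have h0: "h 0 < n" using cayley_iso_lt[OF h] n by simp
  have val: "h (k * t mod n) = (h 0 + t) mod n" for t
    using fun_cong[OF pw[of t], of 0] n h0 by (simp add: rotation_funpow)
  have inj: "inj h" using cayley_iso_permutes[OF h] by (rule permutes_inj)
  obtain t1 where t1: "t1 < n" "h 1 = (h 0 + t1) mod n"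
    using difference_exists[OF h0 cayley_iso_lt[OF h n]] by blast
  have "k * t1 mod n = 1"
    using val[of t1] t1(2) inj by (metis injD)
  then have kt: "[k * t1 = 1] (mod n)"
    using n by (simp add: cong_def)
  then have ktn: "[t1 * k = 1] (mod n)" by (simp add: mult.commute)
  have cop: "coprime t1 n" using ktn by (auto simp: coprime_iff_invertible_nat)
  have iff: "t \<in> T \<longleftrightarrow> k * t mod n \<in> S" if "t < n" for t
  proof -
    have "(0, (0 + k * t mod n) mod n) \<in> cayley n S \<longleftrightarrow> (h 0, (h 0 + t) mod n) \<in> cayley n T"
      using cayley_isoD[OF h, of 0 "k * t mod n"] n val[of t] by simp
    then show ?thesis
      using cayley_iff[OF S, of 0 "k * t mod n"] cayley_iff[OF T h0 that] n by simp
  qed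
  have left: "t1 * (k * t mod n) mod n = t" if "t < n" for t
  proof -
    have "[t1 * (k * t) = 1 * t] (mod n)"
      using cong_mult[OF ktn cong_refl[of t]] by (simp add: mult.assoc)
    then show ?thesis using that by (simp add: cong_def mod_simps)
  qed
  have right: "k * (t1 * s mod n) mod n = s" if "s < n" for s
  proof -
    have "[k * (t1 * s) = 1 * s] (mod n)"
      using cong_mult[OF kt cong_refl[of s]] by (simp add: mult.assoc)
    then show ?thesis using that by (simp add: cong_def mod_simps)
  qed
  have "T = (\<lambda>s. t1 * s mod n) ` S"
  proof (rule equalityI; rule subsetI)
    fix t assume "t \<in> T"
    then have "t < n" "k * t mod n \<in> S" using T iff by auto
    then show "t \<in> (\<lambda>s. t1 * s mod n) ` S"
      using left[of t] by (metis imageI)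
  next
    fix t assume "t \<in> (\<lambda>s. t1 * s mod n) ` S"
    then obtain s where s: "s \<in> S" "t = t1 * s mod n" by blast
    then have "k * t mod n \<in> S" "t < n" using right[of s] S n by auto
    then show "t \<in> T" using iff by blast
  qed
  with cop show ?thesis by blast
qed

text \<open>
  The pullback \<open>\<rho>'\<close> of the rotation along \<open>f\<close> is an automorphism of the first digraph.  Some
  automorphism \<open>g\<close> conjugates its \<open>e\<close>-th power, of order \<open>q\<close>, into the group generated by
  \<open>rotation n ^^ e\<close>.  The conjugate \<open>c\<close> of \<open>\<rho>'\<close> commutes with its own \<open>e\<close>-th power, which generates
  that group; so \<open>c\<close> centralises \<open>rotation n ^^ e\<close> and is itself a rotation, and the composition
  of \<open>f\<close> with the inverse of \<open>g\<close> turns this rotation into the rotation by one.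
\<close>

theorem cayley_iso_imp_multiplier_if_centralizer:
  assumes q: "prime q" and n: "n = e * q" "\<not> q dvd e"
    and S: "S \<subseteq> {..<n}" and T: "T \<subseteq> {..<n}" and f: "cayley_iso n S T f"
    and cent: "\<And>x. cayley_iso n S S x \<Longrightarrow> x \<circ> rotation n ^^ e = rotation n ^^ e \<circ> x \<Longrightarrow>
       \<exists>k. x = rotation n ^^ k"
  shows "\<exists>u. coprime u n \<and> T = (\<lambda>s. u * s mod n) ` S"
proof -
  define \<rho> where "\<rho> = rotation n"
  define G where "G = cayley_aut n S"
  interpret G: group G unfolding G_def by (rule group_cayley_aut)
  have e: "e > 0" using n(2) by (cases e) auto
  have "1 * q \<le> e * q" using e by (intro mult_right_mono) auto
  then have n1: "n > 1" "n > 0" using n(1) prime_gt_1_nat[OF q] by linarith+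
  have \<rho>: "cayley_iso n S S (\<rho> ^^ k)" for k
    unfolding \<rho>_def by (intro cayley_iso_funpow cayley_iso_rotation S)
  have eq: "\<rho> ^^ j = \<rho> ^^ k \<longleftrightarrow> [j = k] (mod n)" for j k
    unfolding \<rho>_def using n1 by (simp add: rotation_funpow_eq_iff)
  have idiff: "\<rho> ^^ k = id \<longleftrightarrow> n dvd k" for k
    unfolding \<rho>_def using n1 by (simp add: rotation_funpow_eq_id_iff)
  define H where "H = (\<lambda>j. \<rho> ^^ (e * j)) ` {..<q}"
  have memH: "\<rho> ^^ (e * j) \<in> H" for j
  proof -
    have "[e * j = e * (j mod q)] (mod n)"
      unfolding n(1) by (simp add: cong_def mod_mult_mult1)
    then show ?thesis
      using eq prime_gt_0_nat[OF q] by (auto simp: H_def intro!: image_eqI[of _ _ "j mod q"])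
  qed
  have cardH: "card H = q"
  proof -
    have "inj_on (\<lambda>j. \<rho> ^^ (e * j)) {..<q}"
      using e by (auto simp: inj_on_def eq n(1) cong_def mod_mult_mult1)
    then show ?thesis by (simp add: H_def card_image)
  qed
  have subH: "subgroup H G"
  proof (rule G.subgroupI)
    show "H \<subseteq> carrier G" using \<rho> by (auto simp: H_def G_def)
    show "H \<noteq> {}" using memH by blast
    fix x y assume x: "x \<in> H"
    then obtain j where j: "x = \<rho> ^^ (e * j)" "j < q" by (auto simp: H_def)
    show "x \<otimes>\<^bsub>G\<^esub> y \<in> H" if "y \<in> H"
    proof -
      obtain i where "y = \<rho> ^^ (e * i)" using \<open>y \<in> H\<close> by (auto simp: H_def)
      then have "x \<otimes>\<^bsub>G\<^esub> y = \<rho> ^^ (e * (j + i))"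
        by (simp add: j G_def funpow_add add_mult_distrib2)
      then show ?thesis using memH by simp
    qed
    have "\<rho> ^^ (e * (q - j)) \<circ> \<rho> ^^ (e * j) = \<rho> ^^ (e * (q - j) + e * j)"
      by (simp only: funpow_add)
    also have "e * (q - j) + e * j = n"
      using j(2) by (simp add: n(1) add_mult_distrib2[symmetric])
    also have "\<rho> ^^ n = id" using idiff[of n] by simp
    finally have "\<rho> ^^ (e * (q - j)) \<otimes>\<^bsub>G\<^esub> x = \<one>\<^bsub>G\<^esub>"
      by (simp only: G_def cayley_aut_simps j(1))
    then have "inv\<^bsub>G\<^esub> x = \<rho> ^^ (e * (q - j))"
      using \<rho> by (intro G.inv_equality) (auto simp: G_def j)
    then show "inv\<^bsub>G\<^esub> x \<in> H" using memH by simp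
  qed
  define a where "a = \<rho> ^^ e"
  have aH: "a \<in> H" using memH[of 1] by (simp add: a_def)
  have a1: "a \<noteq> \<one>\<^bsub>G\<^esub>"
    using idiff[of e] e n prime_gt_1_nat[OF q] by (auto simp: a_def G_def dest!: dvd_imp_le)
  have "{x \<in> carrier G. x \<otimes>\<^bsub>G\<^esub> a = a \<otimes>\<^bsub>G\<^esub> x} = (\<lambda>k. \<rho> ^^ k) ` {..<n}"
  proof (rule equalityI; rule subsetI)
    fix x assume "x \<in> {x \<in> carrier G. x \<otimes>\<^bsub>G\<^esub> a = a \<otimes>\<^bsub>G\<^esub> x}"
    then obtain k where "x = \<rho> ^^ k"
      using cent by (auto simp: G_def a_def \<rho>_def)
    then have "x = \<rho> ^^ (k mod n)" using eq by (simp add: cong_def)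
    then show "x \<in> (\<lambda>k. \<rho> ^^ k) ` {..<n}" using n1 by simp
  next
    fix x assume "x \<in> (\<lambda>k. \<rho> ^^ k) ` {..<n}"
    then show "x \<in> {x \<in> carrier G. x \<otimes>\<^bsub>G\<^esub> a = a \<otimes>\<^bsub>G\<^esub> x}"
      using \<rho> by (auto simp: G_def a_def funpow_add[symmetric] add.commute)
  qed
  moreover have "inj_on (\<lambda>k. \<rho> ^^ k) {..<n}"
    by (auto simp: inj_on_def eq cong_def)
  ultimately have cardC: "card {x \<in> carrier G. x \<otimes>\<^bsub>G\<^esub> a = a \<otimes>\<^bsub>G\<^esub> x} = q * e"
    using n(1) by (simp add: card_image)
  have fp: "f permutes {..<n}" using f by (rule cayley_iso_permutes)
  define \<rho>' where "\<rho>' = perm_inv f \<circ> \<rho> \<circ> f"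
  have \<rho>'k: "\<rho>' ^^ k = perm_inv f \<circ> \<rho> ^^ k \<circ> f" for k
    unfolding \<rho>'_def by (rule funpow_conjugate[OF permutes_inv_comp(2,1)[OF fp]])
  have \<rho>': "cayley_iso n S S \<rho>'"
    unfolding \<rho>'_def \<rho>_def
    by (rule cayley_iso_comp[OF f cayley_iso_comp[OF cayley_iso_rotation[OF T] cayley_iso_inv[OF f]]])
  have "(\<rho>' ^^ e) ^^ q = \<rho>' ^^ (e * q)"
    by (simp add: funpow_mult mult.commute)
  also have "\<dots> = perm_inv f \<circ> \<rho> ^^ n \<circ> f" by (simp only: \<rho>'k n(1))
  also have "\<dots> = id" using idiff[of n] permutes_inv_comp[OF fp] by simp
  finally have bq: "(\<rho>' ^^ e) ^^ q = id" .
  obtain g where g: "g \<in> carrier G" "g \<otimes>\<^bsub>G\<^esub> (\<rho>' ^^ e) \<otimes>\<^bsub>G\<^esub> inv\<^bsub>G\<^esub> g \<in> H"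
    using G.conjugate_into_prime_subgroup[OF _ subH cardH q aH a1 cardC n(2), of "\<rho>' ^^ e"]
      finite_cayley_aut[of n S] cayley_iso_funpow[OF \<rho>'] bq
    by (auto simp: G_def pow_cayley_aut)
  have gi: "cayley_iso n S S g" using g(1) by (simp add: G_def)
  have gp: "g permutes {..<n}" using gi by (rule cayley_iso_permutes)
  define c where "c = g \<circ> \<rho>' \<circ> perm_inv g"
  have ck: "c ^^ k = g \<circ> \<rho>' ^^ k \<circ> perm_inv g" for k
    unfolding c_def by (rule funpow_conjugate[OF permutes_inv_comp(1,2)[OF gp]])
  have ci: "cayley_iso n S S c"
    unfolding c_def
    by (rule cayley_iso_comp[OF cayley_iso_inv[OF gi] cayley_iso_comp[OF \<rho>' gi]])
  have "c ^^ e \<in> H"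
    using g(2) gi by (simp add: G_def inv_cayley_aut ck)
  then obtain j where j: "c ^^ e = \<rho> ^^ (e * j)" by (auto simp: H_def)
  \<comment> \<open>\<open>c ^^ e\<close> generates the same group as \<open>rotation n ^^ e\<close>, because it is not the identity.\<close>
  have "\<not> q dvd j"
  proof
    assume "q dvd j"
    then have "n dvd e * j" by (simp add: n(1))
    then have ce: "g \<circ> \<rho>' ^^ e \<circ> perm_inv g = id" using j idiff ck by metis
    have "\<rho>' ^^ e = (perm_inv g \<circ> g) \<circ> \<rho>' ^^ e \<circ> (perm_inv g \<circ> g)"
      using permutes_inv_comp[OF gp] by simp
    also have "\<dots> = perm_inv g \<circ> (g \<circ> \<rho>' ^^ e \<circ> perm_inv g) \<circ> g" by (simp only: comp_assoc)
    also have "\<dots> = id" using ce permutes_inv_comp[OF gp] by simp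
    finally have fe: "perm_inv f \<circ> \<rho> ^^ e \<circ> f = id" using \<rho>'k by simp
    have "\<rho> ^^ e = (f \<circ> perm_inv f) \<circ> \<rho> ^^ e \<circ> (f \<circ> perm_inv f)"
      using permutes_inv_comp[OF fp] by simp
    also have "\<dots> = f \<circ> (perm_inv f \<circ> \<rho> ^^ e \<circ> f) \<circ> perm_inv f" by (simp only: comp_assoc)
    also have "\<dots> = id" using fe permutes_inv_comp[OF fp] by simp
    finally show False using a1 by (simp add: a_def G_def)
  qed
  then have "coprime j q" using q by (metis prime_imp_coprime coprime_commute)
  then obtain i where "[j * i = 1] (mod q)" using cong_solve_coprime_nat[of j q] by auto
  then have "[e * (j * i) = e] (mod n)"
    using e by (simp add: n(1) cong_def mod_mult_mult1)
  moreover have "c ^^ (e * i) = \<rho> ^^ (e * (j * i))"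
  proof -
    have "c ^^ (e * i) = (c ^^ e) ^^ i" by (simp add: funpow_mult mult.commute)
    also have "\<dots> = \<rho> ^^ (e * (j * i))"
      unfolding j by (simp add: funpow_mult mult.commute mult.left_commute)
    finally show ?thesis .
  qed
  ultimately have "c ^^ (e * i) = \<rho> ^^ e" using eq by metis
  then have "c \<circ> \<rho> ^^ e = \<rho> ^^ e \<circ> c"
    by (metis funpow.simps(2) funpow_Suc_right)
  then obtain k where k: "c = \<rho> ^^ k"
    using cent[OF ci] by (auto simp: \<rho>_def)
  define h where "h = f \<circ> perm_inv g"
  have hi: "cayley_iso n S T h"
    unfolding h_def by (rule cayley_iso_comp[OF cayley_iso_inv[OF gi] f])
  have "h \<circ> c = f \<circ> ((perm_inv g \<circ> g) \<circ> (perm_inv f \<circ> \<rho> \<circ> f) \<circ> perm_inv g)"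
    by (simp only: h_def c_def \<rho>'_def comp_assoc)
  also have "\<dots> = (f \<circ> perm_inv f) \<circ> \<rho> \<circ> f \<circ> perm_inv g"
    using permutes_inv_comp[OF gp] by (simp add: comp_assoc)
  also have "\<dots> = \<rho> \<circ> h"
    using permutes_inv_comp[OF fp] by (simp add: h_def comp_assoc)
  finally show ?thesis
    using cayley_iso_commuting_imp_multiplier[OF n1(1) S T hi, of k] k by (simp add: \<rho>_def)
qed

section \<open>Isomorphic circulants of order q and 2q differ by a multiplier\<close>

lemma commuting_value:
  assumes "x permutes {..<n}" "x \<circ> rotation n ^^ e = rotation n ^^ e \<circ> x" "v < n"
  shows "x ((v + e * j) mod n) = (x v + e * j) mod n"
proof (induction j)
  case 0
  have "x v < n" using permutes_in_image[OF assms(1), of v] assms(3) by simp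
  then show ?case using assms(3) by simp
next
  case (Suc j)
  let ?w = "(v + e * j) mod n"
  have w: "?w < n" using assms(3) by simp
  have xw: "x ?w < n" using permutes_in_image[OF assms(1), of ?w] w by simp
  have "x ((rotation n ^^ e) ?w) = (rotation n ^^ e) (x ?w)"
    using fun_cong[OF assms(2), of ?w] by simp
  then have "x ((?w + e) mod n) = (x ?w + e) mod n"
    using rotation_funpow[OF w, of e] rotation_funpow[OF xw, of e] by simp
  then show ?case using Suc by (simp add: mod_simps algebra_simps)
qed

lemma cayley_iso_imp_multiplier_prime:
  assumes q: "prime q" and S: "S \<subseteq> {..<q}" and T: "T \<subseteq> {..<q}" and f: "cayley_iso q S T f"
  shows "\<exists>u. coprime u q \<and> T = (\<lambda>s. u * s mod q) ` S"
proof (rule cayley_iso_imp_multiplier_if_centralizer[OF q, of q 1, OF _ _ S T f])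
  show "\<not> q dvd 1" using prime_gt_1_nat[OF q] by auto
  fix x assume x: "cayley_iso q S S x" and c: "x \<circ> rotation q ^^ 1 = rotation q ^^ 1 \<circ> x"
  have xp: "x permutes {..<q}" using x by (rule cayley_iso_permutes)
  have q0: "0 < q" using prime_gt_0_nat[OF q] .
  have "x v = (rotation q ^^ x 0) v" for v
  proof (cases "v < q")
    case True
    then show ?thesis
      using commuting_value[OF xp c q0, of v] by (simp add: rotation_funpow add.commute)
  next
    case False
    then show ?thesis
      using permutes_not_in[OF xp, of v] by (simp add: rotation_funpow_outside)
  qed
  then show "\<exists>k. x = rotation q ^^ k" by blast
qed simp

text \<open>
  Circulants are vertex transitive, so an isomorphism may be assumed to fix \<open>0\<close>.
\<close>

lemma exists_normalised_iso:
  assumes "n > 0" "T \<subseteq> {..<n}" "cayley_iso n S T f"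
  shows "cayley_iso n S T (rotation n ^^ (n - f 0) \<circ> f)" "(rotation n ^^ (n - f 0) \<circ> f) 0 = 0"
proof -
  show "cayley_iso n S T (rotation n ^^ (n - f 0) \<circ> f)"
    by (rule cayley_iso_comp[OF assms(3) cayley_iso_funpow[OF cayley_iso_rotation[OF assms(2)]]])
  show "(rotation n ^^ (n - f 0) \<circ> f) 0 = 0"
    using rotation_funpow[of "f 0" n] cayley_iso_lt[OF assms(3,1)] by simp
qed

lemma cong_solve_prime:
  fixes q d c :: nat
  assumes "prime q" "\<not> q dvd d"
  obtains i where "[d * i = c] (mod q)"
proof -
  have "coprime d q" using assms by (metis prime_imp_coprime coprime_commute)
  then obtain j where "[d * j = 1] (mod q)" using cong_solve_coprime_nat[of d q] by auto
  then have "[d * (j * c) = c] (mod q)"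
    using cong_mult[of "d * j" 1 q c c] by (simp add: mult.assoc)
  then show ?thesis using that by blast
qed

lemma cong_double: "[a = b] (mod q) \<Longrightarrow> [2 * a = 2 * b] (mod (2 * q))" for a b q :: nat
  by (simp add: cong_def mod_mult_mult1)

text \<open>
  After composition with a rotation, an automorphism that commutes with the rotation by two fixes
  all even points and shifts the odd points by a constant \<open>2 * d\<close>.  If \<open>d\<close> were not zero, the odd
  part of \<open>S\<close> would be invariant under a shift that acts transitively on the odd residues, so it
  could not contain \<open>s\<close> and omit \<open>t\<close>.
\<close>

lemma centralizer_rotations_double_prime:
  assumes q: "prime q" and n: "n = 2 * q" and S: "S \<subseteq> {..<n}"
    and s: "s \<in> S" "odd s" and t: "t \<notin> S" "odd t" "t < n"
    and x: "cayley_iso n S S x" and c: "x \<circ> rotation n ^^ 2 = rotation n ^^ 2 \<circ> x"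
  shows "\<exists>k. x = rotation n ^^ k"
proof -
  have q0: "q > 0" using prime_gt_0_nat[OF q] .
  have n0: "n > 0" "n > 1" using n q0 by auto
  define y where "y = rotation n ^^ (n - x 0) \<circ> x"
  have y: "cayley_iso n S S y" "y 0 = 0"
    unfolding y_def using exists_normalised_iso[OF n0(1) S x] by auto
  have yp: "y permutes {..<n}" using y(1) by (rule cayley_iso_permutes)
  have "y \<circ> rotation n ^^ 2 = rotation n ^^ (n - x 0) \<circ> (x \<circ> rotation n ^^ 2)"
    by (simp only: y_def comp_assoc)
  also have "\<dots> = (rotation n ^^ (n - x 0) \<circ> rotation n ^^ 2) \<circ> x"
    by (simp only: c comp_assoc)
  also have "\<dots> = (rotation n ^^ 2 \<circ> rotation n ^^ (n - x 0)) \<circ> x"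
    by (simp only: funpow_add[symmetric] add.commute)
  also have "\<dots> = rotation n ^^ 2 \<circ> y"
    by (simp only: y_def comp_assoc)
  finally have yc: "y \<circ> rotation n ^^ 2 = rotation n ^^ 2 \<circ> y" .
  have even: "y (2 * j mod n) = 2 * j mod n" for j
    using commuting_value[OF yp yc n0(1), of j] y(2) by simp
  have y1: "y 1 < n" using cayley_iso_lt[OF y(1) n0(2)] .
  have inj: "inj y" using yp by (rule permutes_inj)
  have "odd (y 1)"
  proof
    assume "even (y 1)"
    then obtain j where j: "y 1 = 2 * j" by blast
    then have "y (y 1) = y 1" using even[of j] y1 by simp
    then have "y 1 = 1" using inj by (metis injD)
    with j show False by simp
  qed
  then obtain d where d: "y 1 = 2 * d + 1" by (rule oddE)
  have odd: "y ((1 + 2 * j) mod n) = (1 + 2 * d + 2 * j) mod n" for j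
    using commuting_value[OF yp yc n0(2), of j] d by simp
  have "d = 0"
  proof (rule ccontr)
    assume d0: "d \<noteq> 0"
    have "d < q" using d y1 n by simp
    then have qd: "\<not> q dvd d" using d0 by (auto dest: dvd_imp_le)
    have step: "r \<in> S \<longleftrightarrow> (r + 2 * d) mod n \<in> S" if r: "r < n" "odd r" for r
    proof -
      obtain j where j: "r = 2 * j + 1" using r(2) by (rule oddE)
      have "y r = (r + 2 * d) mod n" using odd[of j] j r(1) by (simp add: algebra_simps)
      then have "(0, (0 + r) mod n) \<in> cayley n S \<longleftrightarrow> (0, (0 + (r + 2 * d) mod n) mod n) \<in> cayley n S"
        using cayley_isoD[OF y(1) n0(1) r(1)] y(2) r(1) by simp
      then show ?thesis
        using cayley_iff[OF S n0(1) r(1)] cayley_iff[OF S n0(1), of "(r + 2 * d) mod n"] n0 by simp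
    qed
    \<comment> \<open>Repeated shifts stay inside the odd part of \<open>S\<close>; one of them reaches \<open>t\<close>.\<close>
    have many: "(s + 2 * d * i) mod n \<in> S \<and> odd ((s + 2 * d * i) mod n)" for i
    proof (induction i)
      case 0
      then show ?case using s S by auto
    next
      case (Suc i)
      let ?r = "(s + 2 * d * i) mod n"
      have "(?r + 2 * d) mod n \<in> S" using step[of ?r] Suc n0 by simp
      moreover have "odd ((?r + 2 * d) mod n)"
        using Suc n by (simp add: even_mod_2_iff dvd_mod_iff)
      moreover have "(?r + 2 * d) mod n = (s + 2 * d * Suc i) mod n"
        by (simp add: mod_simps algebra_simps)
      ultimately show ?case by simp
    qed
    have sn: "s < n" using s S by auto
    have "even (t + (n - s))" using s(2) t(2) sn n by simp
    then obtain \<delta> where \<delta>: "t + (n - s) = 2 * \<delta>" by blast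
    obtain i where i: "[d * i = \<delta>] (mod q)" using cong_solve_prime[OF q qd] by blast
    have "[s + 2 * d * i = s + 2 * \<delta>] (mod n)"
      using cong_double[OF i] unfolding n by (simp add: mult.assoc cong_add_lcancel_nat)
    also have "s + 2 * \<delta> = t + n" using \<delta> sn by simp
    finally have "(s + 2 * d * i) mod n = t" using t(3) by (simp add: cong_def)
    with many[of i] t(1) show False by simp
  qed
  have "y v = v" for v
  proof (cases "v < n")
    case True
    show ?thesis
    proof (cases "even v")
      case ev: True
      then obtain j where "v = 2 * j" by blast
      then show ?thesis using even[of j] True by simp
    next
      case False
      then obtain j where "v = 2 * j + 1" by (rule oddE)
      then show ?thesis using odd[of j] True \<open>d = 0\<close> by simp
    qed
  next
    case False
    then show ?thesis using permutes_not_in[OF yp] by simp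
  qed
  then have "y = id" by auto
  then have "rotation n ^^ x 0 = rotation n ^^ x 0 \<circ> (rotation n ^^ (n - x 0) \<circ> x)"
    unfolding y_def by simp
  also have "\<dots> = rotation n ^^ (x 0 + (n - x 0)) \<circ> x"
    by (simp only: funpow_add comp_assoc)
  also have "\<dots> = rotation n ^^ n \<circ> x"
    using cayley_iso_lt[OF x n0(1)] by simp
  also have "\<dots> = x"
    using rotation_funpow_eq_id_iff[OF n0(1), of n] by simp
  finally show ?thesis by metis
qed

lemma cayley_iso_card:
  assumes n: "n > 0" and S: "S \<subseteq> {..<n}" and T: "T \<subseteq> {..<n}" and f: "cayley_iso n S T f"
  shows "card S = card T"
proof -
  have fp: "f permutes {..<n}" using f by (rule cayley_iso_permutes)
  have nbrs: "{v \<in> {..<n}. (u, v) \<in> cayley n R} = (\<lambda>r. (u + r) mod n) ` R"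
    if "u < n" "R \<subseteq> {..<n}" for u R
    using that n by (auto simp: cayley_def)
  have card: "card {v \<in> {..<n}. (u, v) \<in> cayley n R} = card R"
    if "u < n" "R \<subseteq> {..<n}" for u R
    unfolding nbrs[OF that]
  proof (rule card_image, rule inj_onI)
    fix x y assume xy: "x \<in> R" "y \<in> R" "(u + x) mod n = (u + y) mod n"
    have "x < n" "y < n" using xy(1,2) that(2) by auto
    then show "x = y" using xy(3) by (rule add_mod_cancel_left)
  qed
  have f0: "f 0 < n" using cayley_iso_lt[OF f n] .
  have "f ` {v \<in> {..<n}. (0, v) \<in> cayley n S} = {w \<in> {..<n}. (f 0, w) \<in> cayley n T}"
  proof (rule equalityI; rule subsetI)
    fix w assume w: "w \<in> {w \<in> {..<n}. (f 0, w) \<in> cayley n T}"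
    then obtain v where "v < n" "w = f v" using permutes_image[OF fp] by blast
    then show "w \<in> f ` {v \<in> {..<n}. (0, v) \<in> cayley n S}"
      using w cayley_isoD[OF f n] by auto
  qed (use cayley_isoD[OF f n] cayley_iso_lt[OF f] in auto)
  moreover have "card (f ` {v \<in> {..<n}. (0, v) \<in> cayley n S}) = card {v \<in> {..<n}. (0, v) \<in> cayley n S}"
    by (rule card_image[OF inj_on_subset[OF permutes_inj[OF fp]]]) (rule subset_UNIV)
  ultimately show ?thesis
    using card[OF n S] card[OF f0 T] by metis
qed

lemma cayley_iso_complement:
  assumes S: "S \<subseteq> {1..<n}" and T: "T \<subseteq> {1..<n}" and f: "cayley_iso n S T f"
  shows "cayley_iso n ({1..<n} - S) ({1..<n} - T) f"
  unfolding cayley_iso_def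
proof (intro conjI allI impI)
  have fp: "f permutes {..<n}" using f by (rule cayley_iso_permutes)
  show "f permutes {..<n}" by (rule fp)
  have compl: "(u, v) \<in> cayley n ({1..<n} - R) \<longleftrightarrow> u \<noteq> v \<and> (u, v) \<notin> cayley n R"
    if uv: "u < n" "v < n" and R: "R \<subseteq> {1..<n}" for u v R
  proof -
    obtain s where s: "s < n" "v = (u + s) mod n" using difference_exists uv by blast
    have "s = 0 \<longleftrightarrow> u = v"
      using s uv add_mod_cancel_left[of s n 0 u] by auto
    moreover have "R \<subseteq> {..<n}" "{1..<n} - R \<subseteq> {..<n}" using R by auto
    ultimately show ?thesis
      using cayley_iff[of R n u s] cayley_iff[of "{1..<n} - R" n u s] uv s by auto
  qed
  fix u v assume uv: "u < n" "v < n"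
  have "u = v \<longleftrightarrow> f u = f v" using inj_eq[OF permutes_inj[OF fp]] by simp
  then show "(u, v) \<in> cayley n ({1..<n} - S) \<longleftrightarrow> (f u, f v) \<in> cayley n ({1..<n} - T)"
    using compl[OF uv S] compl[OF cayley_iso_lt[OF f uv(1)] cayley_iso_lt[OF f uv(2)] T]
      cayley_isoD[OF f uv] by simp
qed

lemma inj_on_mult_mod:
  fixes u n :: nat
  assumes "coprime u n"
  shows "inj_on (\<lambda>s. u * s mod n) {..<n}"
proof (rule inj_onI)
  fix s t assume st: "s \<in> {..<n}" "t \<in> {..<n}" "u * s mod n = u * t mod n"
  then have "[u * s = u * t] (mod n)" by (simp add: cong_def)
  then have "[s = t] (mod n)" using assms by (simp add: cong_mult_lcancel_nat)
  then show "s = t" using st by (simp add: cong_def)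
qed

lemma mult_mod_image_nonzero:
  fixes u n :: nat
  assumes "coprime u n"
  shows "(\<lambda>s. u * s mod n) ` {1..<n} = {1..<n}"
proof (rule endo_inj_surj)
  have inj: "inj_on (\<lambda>s. u * s mod n) {..<n}" using assms by (rule inj_on_mult_mod)
  show "inj_on (\<lambda>s. u * s mod n) {1..<n}" by (rule inj_on_subset[OF inj]) auto
  show "(\<lambda>s. u * s mod n) ` {1..<n} \<subseteq> {1..<n}"
  proof
    fix t assume "t \<in> (\<lambda>s. u * s mod n) ` {1..<n}"
    then obtain s where s: "s \<in> {1..<n}" "t = u * s mod n" by blast
    have "t \<noteq> 0" using inj_onD[OF inj, of s 0] s by auto
    then show "t \<in> {1..<n}" using s by auto
  qed
qed simp

lemma multiplier_inverse:
  fixes u n :: nat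
  assumes "coprime u n" "S \<subseteq> {..<n}" "T = (\<lambda>s. u * s mod n) ` S"
  shows "\<exists>w. coprime w n \<and> S = (\<lambda>s. w * s mod n) ` T"
proof -
  obtain w where w: "[u * w = 1] (mod n)"
    using cong_solve_coprime_nat[OF assms(1)] by auto
  then have wu: "[w * u = 1] (mod n)" by (simp add: mult.commute)
  then have "coprime w n" by (auto simp: coprime_iff_invertible_nat)
  moreover have "w * (u * s mod n) mod n = s" if "s \<in> S" for s
  proof -
    have "[w * (u * s) = 1 * s] (mod n)"
      using cong_mult[OF wu cong_refl[of s]] by (simp add: mult.assoc)
    then show ?thesis using that assms(2) by (auto simp: cong_def mod_simps)
  qed
  then have "S = (\<lambda>s. w * s mod n) ` T"
    unfolding assms(3) image_image by (auto intro!: rev_image_eqI)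
  ultimately show ?thesis by blast
qed

lemma cayley_double:
  assumes S: "S \<subseteq> {..<2 * q}" and uv: "u < q" "v < q"
  shows "(u, v) \<in> cayley q {w. 2 * w \<in> S} \<longleftrightarrow> (2 * u, 2 * v) \<in> cayley (2 * q) S"
proof -
  obtain s where s: "s < q" "v = (u + s) mod q" using difference_exists uv by blast
  have "2 * v = (2 * u + 2 * s) mod (2 * q)"
    unfolding s(2) by (simp only: mult_mod_right add_mult_distrib2)
  moreover have "{w. 2 * w \<in> S} \<subseteq> {..<q}" using S by auto
  ultimately show ?thesis
    using cayley_iff[of "{w. 2 * w \<in> S}" q u s] cayley_iff[OF S, of "2 * u" "2 * s"] uv s by simp
qed

text \<open>
  All arcs join points of equal parity, and a single element of \<open>S\<close> already connects all even
  points.  So an isomorphism fixing \<open>0\<close> maps even points to even points, and halving it gives an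
  isomorphism of circulants of order \<open>q\<close>.  A multiplier modulo \<open>q\<close> lifts to an odd one modulo
  \<open>2 * q\<close>.
\<close>

lemma cayley_iso_imp_multiplier_even:
  assumes q: "prime q" "odd q" and n: "n = 2 * q"
    and S: "S \<subseteq> {1..<n}" "\<forall>s\<in>S. even s" and T: "T \<subseteq> {1..<n}" "\<forall>t\<in>T. even t"
    and f: "cayley_iso n S T f"
  shows "\<exists>u. coprime u n \<and> T = (\<lambda>s. u * s mod n) ` S"
proof (cases "S = {}")
  have q0: "q > 0" using prime_gt_0_nat[OF q(1)] .
  have n0: "n > 0" using n q0 by simp
  have Sn: "S \<subseteq> {..<n}" and Tn: "T \<subseteq> {..<n}" using S T by auto
  case True
  have "finite T" using Tn finite_subset by blast
  then have "T = {}" using cayley_iso_card[OF n0 Sn Tn f] True by simp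
  then show ?thesis using True by (intro exI[of _ 1]) simp
next
  have q0: "q > 0" using prime_gt_0_nat[OF q(1)] .
  have n0: "n > 0" using n q0 by simp
  have Sn: "S \<subseteq> {..<n}" and Tn: "T \<subseteq> {..<n}" using S T by auto
  case False
  then obtain s where s: "s \<in> S" by blast
  then obtain s' where s': "s = 2 * s'" using S(2) by blast
  have "0 < s'" "s' < q" using s s' S(1) n by auto
  then have qs: "\<not> q dvd s'" by (auto dest: dvd_imp_le)
  define h where "h = rotation n ^^ (n - f 0) \<circ> f"
  have h: "cayley_iso n S T h" "h 0 = 0"
    unfolding h_def using exists_normalised_iso[OF n0 Tn f] by auto
  have hp: "h permutes {..<n}" using h(1) by (rule cayley_iso_permutes)
  have walk: "even (h (s * k mod n))" for k
  proof (induction k)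
    case (Suc k)
    let ?u = "s * k mod n" and ?v = "s * Suc k mod n"
    have uv: "?u < n" "?v < n" using n0 by auto
    have "?v = (?u + s) mod n" by (simp add: mod_simps add.commute)
    then have "(?u, ?v) \<in> cayley n S" using cayley_iff[OF Sn uv(1), of s] s Sn by auto
    then have "(h ?u, h ?v) \<in> cayley n T" using cayley_isoD[OF h(1) uv] by simp
    then obtain t where "t \<in> T" "h ?v = (h ?u + t) mod n" by (auto simp: cayley_def)
    then show ?case using Suc T(2) n by (simp add: dvd_mod_iff)
  qed (use h(2) in simp)
  have heven: "even (h (2 * w))" if w: "w < q" for w
  proof -
    obtain k where k: "[s' * k = w] (mod q)" using cong_solve_prime[OF q(1) qs] by blast
    have "[s * k = 2 * w] (mod n)"
      using cong_double[OF k] unfolding n s' by (simp add: mult.assoc)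
    then have "s * k mod n = 2 * w" using w n by (simp add: cong_def)
    then show ?thesis using walk[of k] by simp
  qed
  define S' where "S' = {w. 2 * w \<in> S}"
  define T' where "T' = {w. 2 * w \<in> T}"
  define h' where "h' = (\<lambda>w. if w < q then h (2 * w) div 2 else w)"
  have h': "2 * h' w = h (2 * w)" "h' w < q" if w: "w < q" for w
    using heven[OF w] cayley_iso_lt[OF h(1), of "2 * w"] w n by (auto simp: h'_def)
  have "inj_on h' {..<q}"
  proof (rule inj_onI)
    fix v w assume "v \<in> {..<q}" "w \<in> {..<q}" "h' v = h' w"
    then have "h (2 * v) = h (2 * w)" using h' by (metis lessThan_iff)
    then show "v = w" using inj_eq[OF permutes_inj[OF hp]] by simp
  qed
  moreover have "h' ` {..<q} \<subseteq> {..<q}" using h'(2) by auto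
  ultimately have "bij_betw h' {..<q} {..<q}"
    by (simp add: bij_betw_def endo_inj_surj)
  then have "h' permutes {..<q}"
    by (rule bij_imp_permutes) (simp add: h'_def)
  moreover have "(u, v) \<in> cayley q S' \<longleftrightarrow> (h' u, h' v) \<in> cayley q T'" if uv: "u < q" "v < q" for u v
    using cayley_double[of S q u v] cayley_double[of T q "h' u" "h' v"] Sn Tn uv h'
      cayley_isoD[OF h(1), of "2 * u" "2 * v"]
    unfolding S'_def T'_def n by simp
  ultimately have iso: "cayley_iso q S' T' h'" by (simp add: cayley_iso_def)
  have ST': "S' \<subseteq> {..<q}" "T' \<subseteq> {..<q}" using Sn Tn n by (auto simp: S'_def T'_def)
  obtain u where u: "coprime u q" "T' = (\<lambda>s. u * s mod q) ` S'"
    using cayley_iso_imp_multiplier_prime[OF q(1) ST' iso] by (elim exE conjE)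
  define u' where "u' = (if odd u then u else u + q)"
  have u'c: "[u' = u] (mod q)" by (simp add: u'_def cong_def)
  have "coprime u' q" using u(1) u'c cong_imp_coprime cong_sym by blast
  moreover have "odd u'" using q(2) by (simp add: u'_def)
  ultimately have cop: "coprime u' n" using n by simp
  have dbl: "u' * (2 * w) mod n = 2 * (u * w mod q)" for w
  proof -
    have "[u' * w = u * w] (mod q)" by (rule cong_mult[OF u'c cong_refl])
    then have "[2 * (u' * w) = 2 * (u * w)] (mod n)" unfolding n by (rule cong_double)
    then have "u' * (2 * w) mod n = 2 * (u * w) mod n" by (simp add: cong_def mult.left_commute)
    then show ?thesis unfolding n by (simp only: mult_mod_right)
  qed
  have SS: "S = (\<lambda>w. 2 * w) ` S'" using S(2) by (auto simp: S'_def elim!: evenE)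
  have TT: "T = (\<lambda>w. 2 * w) ` T'" using T(2) by (auto simp: T'_def elim!: evenE)
  have "T = (\<lambda>s. u' * s mod n) ` S"
    unfolding SS TT u(2) image_image dbl ..
  with cop show ?thesis by blast
qed

text \<open>
  If one of the two connection sets contains some but not all odd residues, the centraliser criterion
  applies to it.  Otherwise each of them contains no odd residue or all of them; by cardinality
  the same alternative holds for both sets, and complementation reduces the second alternative to
  the first.
\<close>

theorem cayley_iso_imp_multiplier_double_prime:
  assumes q: "prime q" "odd q" and n: "n = 2 * q"
    and S: "S \<subseteq> {1..<n}" and T: "T \<subseteq> {1..<n}" and f: "cayley_iso n S T f"
  shows "\<exists>u. coprime u n \<and> T = (\<lambda>s. u * s mod n) ` S"
proof -
  have q2: "q > 2" using q prime_ge_2_nat[OF q(1)] by (cases "q = 2") auto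
  have n0: "n > 0" using n q2 by simp
  have Sn: "S \<subseteq> {..<n}" and Tn: "T \<subseteq> {..<n}" using S T by auto
  have q2d: "\<not> q dvd 2" using q2 by (auto dest: dvd_imp_le)
  \<comment> \<open>\<open>mixed\<close> is the hypothesis under which only rotations centralise the rotation by two.\<close>
  define mixed where "mixed = (\<lambda>R. (\<exists>s\<in>R. odd s) \<and> (\<exists>t<n. odd t \<and> t \<notin> R))"
  have generic: "\<exists>u. coprime u n \<and> B = (\<lambda>s. u * s mod n) ` A"
    if "mixed A" "A \<subseteq> {..<n}" "B \<subseteq> {..<n}" "cayley_iso n A B g" for A B g
    using that centralizer_rotations_double_prime[OF q(1) n that(2)]
    by (intro cayley_iso_imp_multiplier_if_centralizer[OF q(1) n q2d]) (auto simp: mixed_def)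
  have odds: "card {t \<in> {..<n}. odd t} = q"
  proof -
    have "{t \<in> {..<n}. odd t} = (\<lambda>j. 2 * j + 1) ` {..<q}"
      unfolding n by (auto elim!: oddE)
    then show ?thesis by (simp add: card_image inj_on_def)
  qed
  have evens: "card {t \<in> {1..<n}. even t} < q"
  proof -
    have "{t \<in> {1..<n}. even t} = (\<lambda>j. 2 * j) ` {1..<q}"
      unfolding n by (auto elim!: evenE)
    then have "card {t \<in> {1..<n}. even t} = q - 1" by (simp add: card_image inj_on_def)
    then show ?thesis using q2 by simp
  qed
  have small: "card R < q" if "R \<subseteq> {1..<n}" "\<forall>s\<in>R. even s" for R
  proof -
    have "card R \<le> card {t \<in> {1..<n}. even t}" using that by (intro card_mono) auto
    then show ?thesis using evens by simp
  qed
  have large: "q \<le> card R" if "R \<subseteq> {1..<n}" "\<forall>t<n. odd t \<longrightarrow> t \<in> R" for R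
  proof -
    have "card {t \<in> {..<n}. odd t} \<le> card R"
      using that finite_subset[OF that(1)] by (intro card_mono) auto
    then show ?thesis using odds by simp
  qed
  have card: "card S = card T" by (rule cayley_iso_card[OF n0 Sn Tn f])
  define none where "none = (\<lambda>R. \<forall>s\<in>R. even (s :: nat))"
  define full where "full = (\<lambda>R. \<forall>t<n. odd t \<longrightarrow> t \<in> R)"
  have split: "mixed R \<or> none R \<or> full R" for R
    by (auto simp: mixed_def none_def full_def)
  have "none S \<Longrightarrow> card S < q" "none T \<Longrightarrow> card T < q"
    "full S \<Longrightarrow> q \<le> card S" "full T \<Longrightarrow> q \<le> card T"
    using small[OF S] small[OF T] large[OF S] large[OF T] by (simp_all add: none_def full_def)
  then consider "mixed S" | "mixed T" | "none S" "none T" | "full S" "full T"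
    using split[of S] split[of T] card by linarith
  then show ?thesis
  proof cases
    case 1
    then show ?thesis by (rule generic[OF _ Sn Tn f])
  next
    case 2
    then obtain u where "coprime u n" "S = (\<lambda>s. u * s mod n) ` T"
      using generic[OF _ Tn Sn cayley_iso_inv[OF f]] by blast
    then show ?thesis using multiplier_inverse[OF _ Tn] by blast
  next
    case 3
    then show ?thesis
      using cayley_iso_imp_multiplier_even[OF q n S _ T _ f] by (simp add: none_def)
  next
    case 4
    have c: "\<forall>s\<in>{1..<n} - S. even s" "\<forall>s\<in>{1..<n} - T. even s" using 4 by (auto simp: full_def)
    obtain u where u: "coprime u n" "{1..<n} - T = (\<lambda>s. u * s mod n) ` ({1..<n} - S)"
      using cayley_iso_imp_multiplier_even[OF q n _ c(1) _ c(2) cayley_iso_complement[OF S T f]]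
      by blast
    have inj: "inj_on (\<lambda>s. u * s mod n) {1..<n}"
      by (rule inj_on_subset[OF inj_on_mult_mod[OF u(1)]]) auto
    have "(\<lambda>s. u * s mod n) ` ({1..<n} - S) = {1..<n} - (\<lambda>s. u * s mod n) ` S"
      using inj_on_image_set_diff[OF inj _ S, of "{1..<n}"] mult_mod_image_nonzero[OF u(1)] by simp
    moreover have "(\<lambda>s. u * s mod n) ` S \<subseteq> {1..<n}"
      using mult_mod_image_nonzero[OF u(1)] S by blast
    ultimately have "T = (\<lambda>s. u * s mod n) ` S" using u(2) T by blast
    with u(1) show ?thesis by blast
  qed
qed

section \<open>Counting orbits and invariant sets of a cyclic group\<close>

lemma minimal_period:
  assumes "m > 0" "(h ^^ m) x = x"
  obtains L where "L > 0" "L dvd m" "\<And>i. (h ^^ i) x = x \<longleftrightarrow> L dvd i"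
proof -
  define L where "L = (LEAST i. i > 0 \<and> (h ^^ i) x = x)"
  have L: "L > 0 \<and> (h ^^ L) x = x"
    unfolding L_def by (rule LeastI[of _ m]) (use assms in simp)
  have iff: "(h ^^ i) x = x \<longleftrightarrow> L dvd i" for i
  proof
    assume "(h ^^ i) x = x"
    then have "(h ^^ (i mod L)) x = x" using funpow_mod_eq[of L h x i] L by simp
    moreover have "i mod L < L" using L by simp
    ultimately have "i mod L = 0"
      using not_less_Least[of "i mod L" "\<lambda>i. i > 0 \<and> (h ^^ i) x = x"] by (auto simp: L_def)
    then show "L dvd i" by (simp add: dvd_eq_mod_eq_0)
  next
    assume "L dvd i"
    then show "(h ^^ i) x = x" using funpow_mult_period[of L h x] L by (auto elim!: dvdE)
  qed
  moreover have "L dvd m" using iff assms(2) by blast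
  ultimately show ?thesis using that L by blast
qed

lemma card_multiples_below:
  fixes m L :: nat
  assumes "L > 0" "L dvd m"
  shows "card {i \<in> {..<m}. L dvd i} = m div L"
proof -
  obtain k where k: "m = L * k" using assms(2) by (rule dvdE)
  have "{i \<in> {..<m}. L dvd i} = (\<lambda>j. L * j) ` {..<k}"
    using assms(1) unfolding k by (auto elim!: dvdE)
  then show ?thesis
    using assms(1) by (simp add: card_image inj_on_def k)
qed

text \<open>
  A point with an orbit of size \<open>L\<close> is fixed by \<open>m div L\<close> of the first \<open>m\<close> powers of \<open>h\<close>, so each orbit
  contributes \<open>m\<close> to the number of pairs of a power and a point fixed by it.
\<close>

theorem burnside_cyclic:
  assumes fin: "finite \<Omega>" and m: "m > 0"
    and closed: "\<And>x. x \<in> \<Omega> \<Longrightarrow> h x \<in> \<Omega>" and period: "\<And>x. x \<in> \<Omega> \<Longrightarrow> (h ^^ m) x = x"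
  shows "m * card (cyclic_orbit h ` \<Omega>) = (\<Sum>i<m. card {x \<in> \<Omega>. (h ^^ i) x = x})"
proof -
  have orb: "card {i \<in> {..<m}. (h ^^ i) x = x} = m div card (cyclic_orbit h x)"
    "card (cyclic_orbit h x) dvd m" if x: "x \<in> \<Omega>" for x
  proof -
    obtain L where L: "L > 0" "L dvd m" "\<And>i. (h ^^ i) x = x \<longleftrightarrow> L dvd i"
      using minimal_period[OF m period[OF x]] by blast
    have "card (cyclic_orbit h x) = L" by (rule card_cyclic_orbit[OF L(1,3)])
    then show "card {i \<in> {..<m}. (h ^^ i) x = x} = m div card (cyclic_orbit h x)"
      "card (cyclic_orbit h x) dvd m"
      using card_multiples_below[OF L(1,2)] L(2,3) by simp_all
  qed
  have fibre: "{x \<in> \<Omega>. cyclic_orbit h x = K} = K" if K: "K \<in> cyclic_orbit h ` \<Omega>" for K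
  proof -
    obtain y where y: "y \<in> \<Omega>" "K = cyclic_orbit h y" using K by blast
    have "K \<subseteq> \<Omega>" using cyclic_orbit_subset[of \<Omega> h y] closed y by simp
    then show ?thesis
      using cyclic_orbit_eq[of m h y] cyclic_orbit_self[of _ h] m period[OF y(1)] y(2) by blast
  qed
  have "(\<Sum>i<m. card {x \<in> \<Omega>. (h ^^ i) x = x}) = (\<Sum>i<m. \<Sum>x\<in>\<Omega>. if (h ^^ i) x = x then 1 else 0)"
    using fin by (simp add: sum.If_cases Int_def)
  also have "\<dots> = (\<Sum>x\<in>\<Omega>. \<Sum>i<m. if (h ^^ i) x = x then 1 else 0)" by (rule sum.swap)
  also have "\<dots> = (\<Sum>x\<in>\<Omega>. card {i \<in> {..<m}. (h ^^ i) x = x})"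
    by (simp add: sum.If_cases Int_def)
  also have "\<dots> = (\<Sum>x\<in>\<Omega>. m div card (cyclic_orbit h x))"
    using orb by (intro sum.cong) auto
  also have "\<dots> = (\<Sum>K\<in>cyclic_orbit h ` \<Omega>. \<Sum>x\<in>{x. x \<in> \<Omega> \<and> cyclic_orbit h x = K}. m div card (cyclic_orbit h x))"
    by (rule sum.image_gen[OF fin])
  also have "\<dots> = (\<Sum>K\<in>cyclic_orbit h ` \<Omega>. m)"
  proof (rule sum.cong[OF refl])
    fix K assume K: "K \<in> cyclic_orbit h ` \<Omega>"
    then have "card K dvd m" using orb(2) by blast
    have "(\<Sum>x\<in>{x. x \<in> \<Omega> \<and> cyclic_orbit h x = K}. m div card (cyclic_orbit h x))
        = (\<Sum>x\<in>{x \<in> \<Omega>. cyclic_orbit h x = K}. m div card K)"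
      by (intro sum.cong) auto
    also have "\<dots> = card K * (m div card K)" using fibre[OF K] by simp
    also have "\<dots> = m" using \<open>card K dvd m\<close> by simp
    finally show "(\<Sum>x\<in>{x. x \<in> \<Omega> \<and> cyclic_orbit h x = K}. m div card (cyclic_orbit h x)) = m" .
  qed
  finally show ?thesis by simp
qed

lemma sum_power_card_Pow:
  fixes w :: "'a :: comm_semiring_1"
  assumes "finite A"
  shows "(\<Sum>B\<in>Pow A. w ^ card B) = (1 + w) ^ card A"
  using prod_add[OF assms, of "\<lambda>_. w" "\<lambda>_. 1"] by (simp add: add.commute)

text \<open>
  An invariant set is a union of orbits, and each of the \<open>card X div L\<close> orbits is chosen or not.
\<close>

theorem sum_invariant_sets:
  fixes w :: "'a :: comm_semiring_1"
  assumes fin: "finite X" and L: "L > 0"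
    and closed: "\<And>x. x \<in> X \<Longrightarrow> h x \<in> X"
    and period: "\<And>x i. x \<in> X \<Longrightarrow> (h ^^ i) x = x \<longleftrightarrow> L dvd i"
  shows "(\<Sum>A | A \<subseteq> X \<and> h ` A = A. w ^ card A) = (1 + w ^ L) ^ (card X div L)"
proof -
  define Q where "Q = cyclic_orbit h ` X"
  have finQ: "finite Q" using fin by (simp add: Q_def)
  have pL: "(h ^^ L) x = x" if "x \<in> X" for x using period[OF that, of L] by simp
  have card_orb: "card K = L" if "K \<in> Q" for K
    using that card_cyclic_orbit[OF L period] by (auto simp: Q_def)
  have disj: "K = K'" if K: "K \<in> Q" "K' \<in> Q" "z \<in> K" "z \<in> K'" for K K' z
  proof -
    obtain x y where "x \<in> X" "K = cyclic_orbit h x" "y \<in> X" "K' = cyclic_orbit h y"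
      using K(1,2) unfolding Q_def by (elim imageE)
    then show ?thesis
      using cyclic_orbit_eq[OF L pL, of x z] cyclic_orbit_eq[OF L pL, of y z] K by simp
  qed
  have UQ: "\<Union>Q = X"
    unfolding Q_def using cyclic_orbit_subset[of X h] closed cyclic_orbit_self[of _ h] by blast
  have card_Un: "card (\<Union>B) = L * card B" if B: "B \<subseteq> Q" for B
  proof -
    have "L * card B = card (\<Union>B)"
    proof (rule card_partition)
      show "finite B" using B finQ by (rule finite_subset)
      show "finite (\<Union>B)" by (rule finite_subset[OF _ fin]) (use B UQ in blast)
      show "card c = L" if "c \<in> B" for c using that B card_orb by blast
      show "c1 \<inter> c2 = {}" if "c1 \<in> B" "c2 \<in> B" "c1 \<noteq> c2" for c1 c2
        using disj[of c1 c2] that B by blast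
    qed
    then show ?thesis by simp
  qed
  have inv_orb: "h ` K = K" if K: "K \<in> Q" for K
  proof -
    obtain x where x: "x \<in> X" "K = cyclic_orbit h x" using K by (auto simp: Q_def)
    have "h ` K \<subseteq> K"
    proof
      fix z assume "z \<in> h ` K"
      then obtain i where "z = (h ^^ Suc i) x" by (auto simp: x(2) cyclic_orbit_def)
      then show "z \<in> K" unfolding x(2) cyclic_orbit_def by blast
    qed
    moreover have "K \<subseteq> h ` K"
    proof
      fix z assume z: "z \<in> K"
      then have zX: "z \<in> X" using UQ K by blast
      have "cyclic_orbit h z = K"
        using cyclic_orbit_eq[OF L pL[OF x(1)]] z x(2) by simp
      moreover have "z = h ((h ^^ (L - 1)) z)"
        using pL[OF zX] L by (metis Suc_diff_1 comp_apply funpow.simps(2))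
      ultimately show "z \<in> h ` K"
        unfolding cyclic_orbit_def by (metis imageI rangeI)
    qed
    ultimately show ?thesis by blast
  qed
  have bij: "bij_betw Union (Pow Q) {A. A \<subseteq> X \<and> h ` A = A}"
    unfolding bij_betw_def
  proof
    show "inj_on Union (Pow Q)"
    proof (rule inj_onI)
      have sub: "B \<subseteq> C" if BC: "B \<subseteq> Q" "C \<subseteq> Q" "\<Union>B = \<Union>C" for B C
      proof
        fix K assume K: "K \<in> B"
        then have "card K \<noteq> 0" using card_orb[of K] L BC(1) by auto
        then obtain x where x: "x \<in> K" by fastforce
        then have "x \<in> \<Union>C" using BC(3) K by blast
        then obtain K' where "K' \<in> C" "x \<in> K'" by blast
        then show "K \<in> C" using disj[of K K' x] x K BC(1,2) by blast
      qed
      fix B C assume "B \<in> Pow Q" "C \<in> Pow Q" "\<Union>B = \<Union>C"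
      then show "B = C" using sub[of B C] sub[of C B] by simp
    qed
    show "Union ` Pow Q = {A. A \<subseteq> X \<and> h ` A = A}"
    proof (rule equalityI; rule subsetI)
      fix A assume "A \<in> Union ` Pow Q"
      then obtain B where B: "B \<subseteq> Q" "A = \<Union>B" by blast
      have "h ` A = (\<Union>K\<in>B. h ` K)" unfolding B(2) by blast
      also have "\<dots> = A" using inv_orb B by (simp add: subset_iff)
      finally show "A \<in> {A. A \<subseteq> X \<and> h ` A = A}" using B UQ by blast
    next
      fix A assume A: "A \<in> {A. A \<subseteq> X \<and> h ` A = A}"
      then have "h x \<in> A" if "x \<in> A" for x using that by blast
      then have "\<Union>(cyclic_orbit h ` A) = A"
        using cyclic_orbit_subset[of A h] cyclic_orbit_self[of _ h] by blast
      moreover have "cyclic_orbit h ` A \<in> Pow Q" using A by (auto simp: Q_def)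
      ultimately show "A \<in> Union ` Pow Q" by (metis imageI)
    qed
  qed
  have "(\<Sum>A | A \<subseteq> X \<and> h ` A = A. w ^ card A) = (\<Sum>B\<in>Pow Q. w ^ card (\<Union>B))"
    by (rule sum.reindex_bij_betw[OF bij, symmetric])
  also have "\<dots> = (\<Sum>B\<in>Pow Q. (w ^ L) ^ card B)"
    by (intro sum.cong refl) (simp add: card_Un power_mult)
  also have "\<dots> = (1 + w ^ L) ^ card Q" by (rule sum_power_card_Pow[OF finQ])
  also have "card Q = card X div L" using card_Un[of Q] UQ L by simp
  finally show ?thesis .
qed

lemma sum_invariant_sets_insert_fixed:
  fixes w :: "'a :: comm_semiring_1"
  assumes fin: "finite X" and z: "z \<notin> X" "h z = z" and closed: "\<And>x. x \<in> X \<Longrightarrow> h x \<in> X"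
  shows "(\<Sum>A | A \<subseteq> insert z X \<and> h ` A = A. w ^ card A) =
    (1 + w) * (\<Sum>A | A \<subseteq> X \<and> h ` A = A. w ^ card A)"
proof -
  define F where "F = {A. A \<subseteq> X \<and> h ` A = A}"
  have finF: "finite F" unfolding F_def by (rule finite_subset[of _ "Pow X"]) (use fin in auto)
  have split: "{A. A \<subseteq> insert z X \<and> h ` A = A} = F \<union> insert z ` F"
  proof (rule equalityI; rule subsetI)
    fix A assume A: "A \<in> {A. A \<subseteq> insert z X \<and> h ` A = A}"
    show "A \<in> F \<union> insert z ` F"
    proof (cases "z \<in> A")
      case True
      have "h ` (A - {z}) \<subseteq> A - {z}" using A z closed by fastforce
      moreover have "A - {z} \<subseteq> h ` (A - {z})" using A z by fastforce
      ultimately have "A - {z} \<in> F" using A by (auto simp: F_def)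
      then show ?thesis using True by (metis UnI2 image_eqI insert_Diff)
    qed (use A in \<open>auto simp: F_def\<close>)
  next
    fix A assume "A \<in> F \<union> insert z ` F"
    then show "A \<in> {A. A \<subseteq> insert z X \<and> h ` A = A}"
      using z(2) by (auto simp: F_def)
  qed
  have "F \<inter> insert z ` F = {}" using z(1) by (auto simp: F_def)
  then have "(\<Sum>A\<in>F \<union> insert z ` F. w ^ card A) = (\<Sum>A\<in>F. w ^ card A) + (\<Sum>A\<in>insert z ` F. w ^ card A)"
    using finF by (simp add: sum.union_disjoint)
  also have "(\<Sum>A\<in>insert z ` F. w ^ card A) = (\<Sum>A\<in>F. w ^ card (insert z A))"
  proof (rule sum.reindex[unfolded comp_def])
    show "inj_on (insert z) F" using z(1) by (auto simp: inj_on_def F_def)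
  qed
  also have "\<dots> = (\<Sum>A\<in>F. w * w ^ card A)"
  proof (rule sum.cong[OF refl])
    fix A assume "A \<in> F"
    then have "finite A" "z \<notin> A" using fin z(1) finite_subset by (auto simp: F_def)
    then show "w ^ card (insert z A) = w * w ^ card A" by simp
  qed
  finally show ?thesis
    unfolding split F_def[symmetric] by (simp add: sum_distrib_left distrib_right sum.distrib)
qed

text \<open>
  There are \<open>totient (m div d)\<close> numbers in \<open>{0<..m}\<close> whose \<open>gcd\<close> with \<open>m\<close> is the divisor \<open>d\<close>; the
  index \<open>0\<close> of the left-hand sum plays the part of \<open>m\<close>.
\<close>

lemma sum_gcd_eq_sum_divisors:
  fixes F :: "nat \<Rightarrow> 'a :: comm_semiring_1"
  assumes m: "m > 0"
  shows "(\<Sum>i<m. F (gcd i m)) = (\<Sum>r | r dvd m. of_nat (totient r) * F (m div r))"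
proof -
  have "(\<Sum>i<m. F (gcd i m)) = (\<Sum>i\<in>{0<..m}. F (gcd i m))"
  proof (rule sum.reindex_bij_witness[of _ "\<lambda>i. if i = m then 0 else i" "\<lambda>i. if i = 0 then m else i"])
  qed (use m in auto)
  also have "\<dots> = (\<Sum>d\<in>(\<lambda>i. gcd i m) ` {0<..m}. \<Sum>i\<in>{i. i \<in> {0<..m} \<and> gcd i m = d}. F (gcd i m))"
    by (rule sum.image_gen) simp
  also have "(\<lambda>i. gcd i m) ` {0<..m} = {d. d dvd m}"
  proof (rule equalityI; rule subsetI)
    fix d assume "d \<in> {d. d dvd m}"
    then have "gcd d m = d" "d \<in> {0<..m}" using m by (auto dest: dvd_imp_le intro: Nat.gr0I simp: gcd_proj1_iff)
    then show "d \<in> (\<lambda>i. gcd i m) ` {0<..m}" by (metis imageI)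
  qed auto
  also have "(\<Sum>d\<in>{d. d dvd m}. \<Sum>i\<in>{i. i \<in> {0<..m} \<and> gcd i m = d}. F (gcd i m)) =
      (\<Sum>d | d dvd m. of_nat (totient (m div d)) * F d)"
  proof (rule sum.cong[OF refl])
    fix d assume d: "d \<in> {d. d dvd m}"
    have "(\<Sum>i\<in>{i. i \<in> {0<..m} \<and> gcd i m = d}. F (gcd i m)) = (\<Sum>i\<in>{i \<in> {0<..m}. gcd i m = d}. F d)"
      by (intro sum.cong) auto
    then show "(\<Sum>i\<in>{i. i \<in> {0<..m} \<and> gcd i m = d}. F (gcd i m)) = of_nat (totient (m div d)) * F d"
      using card_gcd_eq_totient[OF m, of d] d by simp
  qed
  also have "\<dots> = (\<Sum>r | r dvd m. of_nat (totient r) * F (m div r))"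
    by (rule sum.reindex_bij_witness[of _ "\<lambda>r. m div r" "\<lambda>d. m div d"]) (use m in auto)
  finally show ?thesis .
qed

section \<open>The multiplier group modulo q and 2q\<close>

definition scale :: "nat \<Rightarrow> nat \<Rightarrow> nat \<Rightarrow> nat" where
  "scale n g x = g * x mod n"

lemma scale_funpow: "x < n \<Longrightarrow> (scale n g ^^ i) x = g ^ i * x mod n"
  by (induction i) (simp_all add: scale_def mod_mult_right_eq mult.assoc)

lemma image_funpow:
  fixes h :: "'a \<Rightarrow> 'a"
  shows "((`) h ^^ i) A = (h ^^ i) ` A"
proof (induction i)
  case (Suc i)
  have "((`) h ^^ Suc i) A = h ` ((`) h ^^ i) A" by (simp only: funpow.simps comp_apply)
  also have "\<dots> = (h ^^ Suc i) ` A" by (simp only: Suc image_comp funpow.simps)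
  finally show ?case .
qed simp

text \<open>
  The unit groups modulo \<open>q\<close> and \<open>2 * q\<close> are isomorphic and cyclic.  An odd primitive root modulo
  \<open>q\<close> generates both, which allows the two orders to be treated together.
\<close>

locale multiplier_generator =
  fixes q n g :: nat
  assumes q: "prime q" "odd q" and n: "n = q \<or> n = 2 * q"
    and g: "residue_primroot q g" and odd_g: "n = 2 * q \<Longrightarrow> odd g"
begin

abbreviation \<phi> :: "nat \<Rightarrow> nat" where "\<phi> \<equiv> scale n g"

lemma q_gt_2: "q > 2"
  using q prime_ge_2_nat[OF q(1)] by (cases "q = 2") auto

lemma n_pos: "n > 0"
  using n q_gt_2 by auto

lemma totient_q: "totient q = q - 1"
  using q(1) by (rule totient_prime)

text \<open>
  Powers of \<open>g\<close> are odd if \<open>n = 2 * q\<close>, so this reduces statements about them to the modulus \<open>q\<close>.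
\<close>

lemma cong_n_iff: "[a = b] (mod n) \<longleftrightarrow> [a = b] (mod q) \<and> (n = 2 * q \<longrightarrow> even a = even b)"
proof (cases "n = 2 * q")
  case True
  have "coprime 2 q" using q(2) by simp
  then have "[a = b] (mod 2 * q) \<longleftrightarrow> [a = b] (mod 2) \<and> [a = b] (mod q)"
    using coprime_cong_mult_nat[of a b 2 q]
    by (metis cong_modulus_mult_nat mult.commute)
  moreover have "[a = b] (mod 2) \<longleftrightarrow> even a = even b"
    unfolding cong_def by (metis even_iff_mod_2_eq_zero odd_iff_mod_2_eq_one)
  ultimately show ?thesis using True by auto
next
  case False
  then show ?thesis using n by auto
qed

lemma power_g_cong_1_iff: "[g ^ i = 1] (mod q) \<longleftrightarrow> q - 1 dvd i"
  using g ord_divides[of g i q] totient_q by (simp add: residue_primroot_def)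

lemma odd_power_g: "n = 2 * q \<Longrightarrow> odd (g ^ i)"
  using odd_g by simp

lemma coprime_g_n: "coprime g n"
proof -
  have "coprime g q" using g by (simp add: residue_primroot_def coprime_commute)
  then show ?thesis using n odd_g by auto
qed

lemma power_g_surj:
  assumes "coprime u n"
  shows "\<exists>i. [u = g ^ i] (mod n)"
proof -
  have "coprime q u" using assms n by (auto simp: coprime_commute)
  then have "coprime q (u mod q)" using q_gt_2 by simp
  moreover have "u mod q \<noteq> 0"
    using \<open>coprime q u\<close> q_gt_2 by (auto simp: dvd_eq_mod_eq_0[symmetric] coprime_absorb_left)
  ultimately have "u mod q \<in> totatives q"
    using q_gt_2 by (auto simp: totatives_def coprime_commute intro: less_imp_le)
  then obtain i where "u mod q = g ^ i mod q"
    using residue_primroot_is_generator[OF _ g] q_gt_2 by (auto simp: bij_betw_def)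
  then have "[u = g ^ i] (mod q)" by (simp add: cong_def)
  moreover have "even u = even (g ^ i)" if "n = 2 * q"
    using odd_power_g[OF that] assms that by auto
  ultimately show ?thesis using cong_n_iff by blast
qed

lemma power_g_half: "[g ^ ((q - 1) div 2) = n - 1] (mod n)"
proof -
  define x where "x = g ^ ((q - 1) div 2)"
  have "x * x = g ^ (2 * ((q - 1) div 2))"
    by (simp add: x_def power_add[symmetric] mult_2)
  also have "2 * ((q - 1) div 2) = q - 1" using q(2) by simp
  finally have xx: "[x * x = 1] (mod q)" using power_g_cong_1_iff[of "q - 1"] by simp
  have x1: "\<not> [x = 1] (mod q)"
    using power_g_cong_1_iff[of "(q - 1) div 2"] q_gt_2 by (auto simp: x_def dest!: dvd_imp_le)
  have x0: "x > 0" using xx q_gt_2 by (auto simp: cong_def intro!: Nat.gr0I)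
  have "(x - 1) * (x + 1) + 1 = x * x" using x0 by (cases x) auto
  then have "q dvd (x - 1) * (x + 1)"
    using xx by (metis cong_add_rcancel_0_nat cong_0_iff)
  moreover have "\<not> q dvd x - 1"
    using x1 x0 by (metis cong_0_iff cong_add_rcancel_0_nat le_add_diff_inverse2 Suc_leI One_nat_def)
  ultimately have "q dvd x + 1" using prime_dvd_multD[OF q(1)] by blast
  moreover have "q dvd (n - 1) + 1" using n n_pos by auto
  ultimately have "[x + 1 = (n - 1) + 1] (mod q)" by (simp add: cong_def mod_0_imp_dvd dvd_imp_mod_0)
  then have "[x = n - 1] (mod q)" by (simp only: cong_add_rcancel_nat)
  moreover have "even x = even (n - 1)" if "n = 2 * q"
    using odd_power_g[OF that, of "(q - 1) div 2"] that n_pos by (simp add: x_def)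
  ultimately show ?thesis using cong_n_iff by (simp add: x_def)
qed

lemma \<phi>_closed: "x \<in> {1..<n} \<Longrightarrow> \<phi> x \<in> {1..<n}"
proof -
  assume x: "x \<in> {1..<n}"
  have "\<not> n dvd g * x"
    using coprime_g_n x by (auto simp: coprime_dvd_mult_right_iff coprime_commute dest: dvd_imp_le)
  then show "\<phi> x \<in> {1..<n}"
    using n_pos by (auto simp: scale_def mod_greater_zero_iff_not_dvd Suc_le_eq)
qed

text \<open>
  The residues on which the multiplier group acts freely: all nonzero ones except, if \<open>n = 2 * q\<close>,
  the point \<open>q\<close>.
\<close>

definition free_points :: "nat set" where
  "free_points = {x \<in> {1..<n}. \<not> q dvd x}"

lemma \<phi>_closed_free: "x \<in> free_points \<Longrightarrow> \<phi> x \<in> free_points"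
proof -
  assume x: "x \<in> free_points"
  have "q dvd n" using n by auto
  moreover have "\<not> q dvd g * x"
    using x g q(1) by (auto simp: free_points_def prime_dvd_mult_iff residue_primroot_def
        coprime_absorb_left dest: prime_gt_1_nat)
  ultimately have "\<not> q dvd \<phi> x" by (simp add: scale_def dvd_mod_iff)
  then show "\<phi> x \<in> free_points" using \<phi>_closed x by (simp add: free_points_def)
qed

lemma \<phi>_period: "x \<in> free_points \<Longrightarrow> (\<phi> ^^ i) x = x \<longleftrightarrow> q - 1 dvd i"
proof -
  assume x: "x \<in> free_points"
  have xn: "x < n" using x by (simp add: free_points_def)
  have cop: "coprime x q"
    using x q(1) by (metis (mono_tags, lifting) free_points_def mem_Collect_eq prime_imp_coprime coprime_commute)
  have "(\<phi> ^^ i) x = x \<longleftrightarrow> [g ^ i * x = 1 * x] (mod n)"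
    using xn by (simp add: scale_funpow cong_def)
  also have "\<dots> \<longleftrightarrow> [g ^ i * x = 1 * x] (mod q)"
    using odd_power_g[of i] by (auto simp: cong_n_iff)
  also have "\<dots> \<longleftrightarrow> [g ^ i = 1] (mod q)"
    using cop by (rule cong_mult_rcancel_nat)
  also have "\<dots> \<longleftrightarrow> q - 1 dvd i" by (rule power_g_cong_1_iff)
  finally show ?thesis .
qed

lemma multiples_below_n: "{x \<in> {1..<n}. q dvd x} = (if n = q then {} else {q})"
proof -
  have le: "n \<le> 2 * q" using n by auto
  have one: "x = q" if x: "x \<in> {1..<n}" "q dvd x" for x
  proof -
    obtain k where k: "x = q * k" using x(2) by (rule dvdE)
    have "q * k < n" using x(1) k by simp
    then have "q * k < q * 2" using le by linarith
    then have "k < 2" by simp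
    moreover have "k > 0" using x(1) k by (cases k) auto
    ultimately have "k = 1" by simp
    then show ?thesis using k by simp
  qed
  show ?thesis
  proof (cases "n = q")
    case True
    have "x \<notin> {x \<in> {1..<n}. q dvd x}" for x using one[of x] True by auto
    then show ?thesis using True by simp
  next
    case False
    then have "n = 2 * q" using n by simp
    then have "q \<in> {x \<in> {1..<n}. q dvd x}" using q_gt_2 by simp
    then show ?thesis using one False by auto
  qed
qed

lemma n_div_q: "n div q = (if n = q then 1 else 2)" "n = n div q * q"
  using n q_gt_2 by (elim disjE; simp)+

lemma card_free_points: "card free_points = (n div q) * (q - 1)"
proof -
  have c: "card {x \<in> {1..<n}. q dvd x} = n div q - 1"
    by (simp only: multiples_below_n n_div_q(1)) simp
  have "free_points = {1..<n} - {x \<in> {1..<n}. q dvd x}" by (auto simp: free_points_def)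
  also have "card \<dots> = card {1..<n} - card {x \<in> {1..<n}. q dvd x}"
    by (rule card_Diff_subset) auto
  also have "\<dots> = n - 1 - (n div q - 1)" by (simp only: c card_atLeastLessThan)
  also have "\<dots> = n div q * q - 1 - (n div q - 1)" using n_div_q(2) by simp
  also have "\<dots> = (n div q) * (q - 1)"
    by (simp only: n_div_q(1)) (simp add: diff_mult_distrib2)
  finally show ?thesis .
qed

lemma points_split:
  "{1..<n} = (if n = q then free_points else insert q free_points)"
proof -
  have "{1..<n} = free_points \<union> {x \<in> {1..<n}. q dvd x}" by (auto simp: free_points_def)
  then show ?thesis by (simp only: multiples_below_n) simp
qed

lemma \<phi>_q: "n = 2 * q \<Longrightarrow> \<phi> q = q"
proof -
  assume "n = 2 * q"
  then have "[g * q = q] (mod n)"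
    using odd_g by (subst cong_n_iff) (simp add: cong_def)
  then show "\<phi> q = q" using \<open>n = 2 * q\<close> q_gt_2 by (simp add: scale_def cong_def)
qed

text \<open>
  The fixed point \<open>q\<close>, present if \<open>n = 2 * q\<close>, may be added to any invariant set of free points.
\<close>

definition fixed_point_factor :: "rat poly \<Rightarrow> rat poly" where
  "fixed_point_factor w = (if n = q then 1 else 1 + w)"

lemma sum_fixed_sets:
  assumes d: "d > 0" "d dvd q - 1"
  shows "(\<Sum>A | A \<subseteq> {1..<n} \<and> (\<phi> ^^ d) ` A = A. w ^ card A) =
    fixed_point_factor w * (1 + w ^ ((q - 1) div d)) ^ (n div q * d)"
proof -
  define L where "L = (q - 1) div d"
  have Ld: "q - 1 = d * L" using d by (simp add: L_def)
  have L0: "L > 0" using Ld q_gt_2 by (cases L) auto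
  have fin: "finite free_points" by (simp add: free_points_def)
  have cl: "(\<phi> ^^ d) x \<in> free_points" if "x \<in> free_points" for x
    using funpow_closed[of free_points \<phi> x d] \<phi>_closed_free that by simp
  have per: "((\<phi> ^^ d) ^^ i) x = x \<longleftrightarrow> L dvd i" if "x \<in> free_points" for x i
  proof -
    have "((\<phi> ^^ d) ^^ i) x = (\<phi> ^^ (d * i)) x" by (simp add: funpow_mult)
    then show ?thesis using \<phi>_period[OF that, of "d * i"] Ld d(1) by simp
  qed
  have free: "(\<Sum>A | A \<subseteq> free_points \<and> (\<phi> ^^ d) ` A = A. w ^ card A) =
      (1 + w ^ L) ^ (card free_points div L)"
    by (rule sum_invariant_sets[OF fin L0 cl per])
  have e: "card free_points div L = n div q * d"
  proof -
    have "card free_points = n div q * d * L"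
      by (simp only: card_free_points Ld mult.assoc)
    then show ?thesis using L0 by simp
  qed
  show ?thesis
  proof (cases "n = q")
    case True
    have pts: "{1..<n} = free_points" using points_split True by simp
    have ext: "fixed_point_factor w = 1" unfolding fixed_point_factor_def using True by simp
    show ?thesis by (simp only: pts ext free e mult_1_left L_def[symmetric])
  next
    case False
    then have n2: "n = 2 * q" using n by simp
    have "(\<phi> ^^ k) q = q" for k by (induction k) (simp_all add: \<phi>_q[OF n2])
    then have "(\<Sum>A | A \<subseteq> insert q free_points \<and> (\<phi> ^^ d) ` A = A. w ^ card A) =
      (1 + w) * (\<Sum>A | A \<subseteq> free_points \<and> (\<phi> ^^ d) ` A = A. w ^ card A)"
      using sum_invariant_sets_insert_fixed[OF fin, of q "\<phi> ^^ d" w] cl by (simp add: free_points_def)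
    then show ?thesis using free e points_split False by (simp add: fixed_point_factor_def L_def)
  qed
qed

definition invariant_sets :: "nat \<Rightarrow> nat set set" where
  "invariant_sets m = {A. A \<subseteq> {1..<n} \<and> (\<phi> ^^ m) ` A = A}"

lemma inj_on_\<phi>: "inj_on \<phi> {1..<n}"
  unfolding scale_def by (rule inj_on_subset[OF inj_on_mult_mod[OF coprime_g_n]]) auto

lemma invariant_sets_closed:
  assumes "A \<in> invariant_sets m"
  shows "\<phi> ` A \<in> invariant_sets m" "card (\<phi> ` A) = card A"
proof -
  have A: "A \<subseteq> {1..<n}" "(\<phi> ^^ m) ` A = A" using assms by (auto simp: invariant_sets_def)
  show "card (\<phi> ` A) = card A" by (rule card_image[OF inj_on_subset[OF inj_on_\<phi> A(1)]])
  have "(\<phi> ^^ m) ` \<phi> ` A = \<phi> ` (\<phi> ^^ m) ` A" by (simp add: image_image funpow_swap1)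
  moreover have "\<phi> ` A \<subseteq> {1..<n}" using A(1) \<phi>_closed by blast
  ultimately show "\<phi> ` A \<in> invariant_sets m" using A(2) by (simp add: invariant_sets_def)
qed

text \<open>
  By Bezout's identity, \<open>\<phi> ^^ i\<close> and \<open>\<phi> ^^ gcd i m\<close> generate the same group modulo powers of
  \<open>\<phi> ^^ m\<close>.
\<close>

lemma fixed_gcd:
  assumes m: "m > 0" and A: "(\<phi> ^^ m) ` A = A"
  shows "(\<phi> ^^ i) ` A = A \<longleftrightarrow> (\<phi> ^^ gcd i m) ` A = A"
proof
  have mult: "(\<phi> ^^ (a * k)) ` A = A" if "(\<phi> ^^ a) ` A = A" for a k
    using funpow_mult_period[of a "(`) \<phi>" A k] that by (simp add: image_funpow)
  {
    assume "(\<phi> ^^ gcd i m) ` A = A"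
    then show "(\<phi> ^^ i) ` A = A"
      using mult[of "gcd i m" "i div gcd i m"] by simp
  next
    assume i: "(\<phi> ^^ i) ` A = A"
    obtain x y where xy: "m * x = i * y + gcd m i"
      using bezout_nat[of m i] m by auto
    have "A = (\<phi> ^^ (m * x)) ` A" using mult[OF A] by simp
    also have "\<dots> = (\<phi> ^^ gcd m i) ` (\<phi> ^^ (i * y)) ` A"
      unfolding xy by (simp add: funpow_add image_image add.commute)
    also have "\<dots> = (\<phi> ^^ gcd i m) ` A"
      using mult[OF i] by (simp add: gcd.commute)
    finally show "(\<phi> ^^ gcd i m) ` A = A" by simp
  }
qed

text \<open>
  Burnside's lemma for the group generated by \<open>\<phi>\<close> modulo \<open>\<phi> ^^ m\<close>, weighted by cardinality.  The
  \<open>i\<close>-th power fixes the same invariant sets as \<open>\<phi> ^^ gcd i m\<close>, whose orbits on the free points all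
  have size \<open>(q - 1) div gcd i m\<close>.  The choice \<open>m = q - 1\<close> counts directed circulants, and
  \<open>m = (q - 1) div 2\<close>, where \<open>\<phi> ^^ m\<close> is negation, counts undirected ones.
\<close>

theorem orbit_enumerator:
  fixes w :: "rat poly"
  assumes m: "m > 0" "m dvd q - 1"
  shows "of_nat m * (\<Sum>r<n. of_nat (card (cyclic_orbit ((`) \<phi>) ` {A \<in> invariant_sets m. card A = r})) * w ^ r) =
    fixed_point_factor w * (\<Sum>r | r dvd m. of_nat (totient r) *
      (1 + w ^ ((q - 1) div m * r)) ^ (n div q * (m div r)))"
proof -
  define \<Phi> where "\<Phi> = (`) \<phi>"
  define \<Omega> where "\<Omega> = (\<lambda>r. {A \<in> invariant_sets m. card A = r})"
  have fin: "finite (invariant_sets m)"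
    unfolding invariant_sets_def by (rule finite_subset[of _ "Pow {1..<n}"]) auto
  have closed: "\<Phi> A \<in> \<Omega> r" if "A \<in> \<Omega> r" for A r
    using invariant_sets_closed[of A m] that by (simp add: \<Omega>_def \<Phi>_def)
  have pw: "(\<Phi> ^^ i) A = (\<phi> ^^ i) ` A" for i A by (simp add: \<Phi>_def image_funpow)
  have burn: "m * card (cyclic_orbit \<Phi> ` \<Omega> r) = (\<Sum>i<m. card {A \<in> \<Omega> r. (\<phi> ^^ i) ` A = A})" for r
    using burnside_cyclic[of "\<Omega> r" m \<Phi>] closed fin m(1)
    by (simp add: pw \<Omega>_def invariant_sets_def)
  have fixed: "(\<Sum>r<n. of_nat (card {A \<in> \<Omega> r. (\<phi> ^^ i) ` A = A}) * w ^ r) =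
      fixed_point_factor w * (1 + w ^ ((q - 1) div gcd i m)) ^ (n div q * gcd i m)" for i
  proof -
    let ?B = "{A. A \<subseteq> {1..<n} \<and> (\<phi> ^^ gcd i m) ` A = A}"
    have inv: "{A \<in> invariant_sets m. (\<phi> ^^ i) ` A = A} = ?B"
    proof (rule Set.set_eqI)
      fix A show "A \<in> {A \<in> invariant_sets m. (\<phi> ^^ i) ` A = A} \<longleftrightarrow> A \<in> ?B"
      proof (cases "(\<phi> ^^ m) ` A = A")
        case True
        show ?thesis using fixed_gcd[OF m(1) True, of i] True unfolding invariant_sets_def by simp
      next
        case False
        then have "(\<phi> ^^ gcd i m) ` A \<noteq> A"
          using funpow_mult_period[of "gcd i m" "(`) \<phi>" A "m div gcd i m"] by (auto simp: image_funpow)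
        with False show ?thesis unfolding invariant_sets_def by simp
      qed
    qed
    have finB: "finite ?B" by (rule finite_subset[of _ "Pow {1..<n}"]) auto
    have "(\<Sum>r<n. of_nat (card {A \<in> \<Omega> r. (\<phi> ^^ i) ` A = A}) * w ^ r) =
        (\<Sum>r<n. \<Sum>A\<in>{A \<in> ?B. card A = r}. w ^ card A)"
    proof (rule sum.cong[OF refl])
      fix r
      have "{A \<in> \<Omega> r. (\<phi> ^^ i) ` A = A} = {A \<in> ?B. card A = r}"
        unfolding inv[symmetric] by (auto simp: \<Omega>_def)
      then show "of_nat (card {A \<in> \<Omega> r. (\<phi> ^^ i) ` A = A}) * w ^ r =
          (\<Sum>A\<in>{A \<in> ?B. card A = r}. w ^ card A)"
        by simp
    qed
    also have "\<dots> = (\<Sum>A\<in>?B. w ^ card A)"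
    proof (rule sum.group[OF finB])
      show "card ` ?B \<subseteq> {..<n}"
      proof
        fix c assume "c \<in> card ` ?B"
        then obtain A where "A \<subseteq> {1..<n}" "c = card A" by blast
        then have "c \<le> n - 1" using card_mono[of "{1..<n}" A] by simp
        then show "c \<in> {..<n}" using n_pos by simp
      qed
    qed simp
    also have "\<dots> = fixed_point_factor w * (1 + w ^ ((q - 1) div gcd i m)) ^ (n div q * gcd i m)"
      using m by (intro sum_fixed_sets) (auto intro: dvd_trans)
    finally show ?thesis .
  qed
  have "of_nat m * (\<Sum>r<n. of_nat (card (cyclic_orbit \<Phi> ` \<Omega> r)) * w ^ r) =
      (\<Sum>r<n. of_nat (m * card (cyclic_orbit \<Phi> ` \<Omega> r)) * w ^ r)"
    by (simp add: sum_distrib_left mult.assoc)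
  also have "\<dots> = (\<Sum>r<n. \<Sum>i<m. of_nat (card {A \<in> \<Omega> r. (\<phi> ^^ i) ` A = A}) * w ^ r)"
    by (simp only: burn of_nat_sum sum_distrib_right)
  also have "\<dots> = (\<Sum>i<m. \<Sum>r<n. of_nat (card {A \<in> \<Omega> r. (\<phi> ^^ i) ` A = A}) * w ^ r)"
    by (rule sum.swap)
  also have "\<dots> = fixed_point_factor w * (\<Sum>i<m. (1 + w ^ ((q - 1) div gcd i m)) ^ (n div q * gcd i m))"
    by (simp only: fixed sum_distrib_left)
  also have "(\<Sum>i<m. (1 + w ^ ((q - 1) div gcd i m)) ^ (n div q * gcd i m)) =
      (\<Sum>r | r dvd m. of_nat (totient r) * (1 + w ^ ((q - 1) div (m div r))) ^ (n div q * (m div r)))"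
    by (rule sum_gcd_eq_sum_divisors[OF m(1)])
  also have "\<dots> = (\<Sum>r | r dvd m. of_nat (totient r) *
      (1 + w ^ ((q - 1) div m * r)) ^ (n div q * (m div r)))"
  proof (rule sum.cong[OF refl])
    fix r assume "r \<in> {r. r dvd m}"
    then obtain s where s: "m = r * s" by auto
    obtain t where t: "q - 1 = m * t" using m(2) by auto
    have "(q - 1) div (m div r) = (q - 1) div m * r"
      using m(1) unfolding t s by simp
    then show "of_nat (totient r) * (1 + w ^ ((q - 1) div (m div r))) ^ (n div q * (m div r)) =
        of_nat (totient r) * (1 + w ^ ((q - 1) div m * r)) ^ (n div q * (m div r))" by simp
  qed
  finally show ?thesis unfolding \<Phi>_def \<Omega>_def .
qed

end

lemma multiplier_generator_exists:
  assumes "prime q" "odd q" "n = q \<or> n = 2 * q"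
  obtains g where "multiplier_generator q n g"
proof -
  obtain g where "\<forall>k>0. residue_primroot (q ^ k) g"
    using residue_primroot_odd_prime_power_exists[OF assms(1,2)] by blast
  then have g: "residue_primroot q g" by (metis power_one_right zero_less_one)
  \<comment> \<open>Adding the odd number \<open>q\<close> makes an even primitive root odd.\<close>
  define g' where "g' = (if odd g then g else g + q)"
  have "residue_primroot q g'"
    using g residue_primroot_cong[of g "g + q" q] by (simp add: g'_def cong_def)
  moreover have "odd g'" using assms(2) by (simp add: g'_def)
  ultimately have "multiplier_generator q n g'"
    using assms by unfold_locales auto
  then show ?thesis using that by blast
qed

section \<open>Circulant digraphs and their connection sets\<close>

definition connection :: "nat pair_pre_digraph \<Rightarrow> nat set" where
  "connection G = {s. (0, s) \<in> parcs G}"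

definition cayley_digraph :: "nat \<Rightarrow> nat set \<Rightarrow> nat pair_pre_digraph" where
  "cayley_digraph n S = \<lparr>pverts = {..<n}, parcs = cayley n S\<rparr>"

text \<open>
  Invariance under the unit shift moves every arc to one that starts at \<open>0\<close>.
\<close>

lemma circulant_connection:
  assumes n: "n > 0" and G: "circulant n G"
  shows "connection G \<subseteq> {1..<n}" "parcs G = cayley n (connection G)"
proof -
  interpret pair_digraph G using G by (simp add: circulant_def)
  have V: "pverts G = {..<n}" using G by (simp add: circulant_def)
  have lt: "u < n" "v < n" if "(u, v) \<in> parcs G" for u v
    using in_arcsD1[OF that] in_arcsD2[OF that] V by auto
  show "connection G \<subseteq> {1..<n}"
  proof
    fix s assume "s \<in> connection G"
    then have s: "(0, s) \<in> parcs G" by (simp add: connection_def)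
    then have "s \<noteq> 0" using no_loops'[OF s] by simp
    then show "s \<in> {1..<n}" using lt(2)[OF s] by simp
  qed
  have "(\<lambda>(u, v). ((u + 1) mod n, (v + 1) mod n)) ` parcs G = parcs G"
    using G by (simp add: circulant_def)
  then have step: "((u + 1) mod n, (v + 1) mod n) \<in> parcs G" if "(u, v) \<in> parcs G" for u v
    using that by (metis (mono_tags, lifting) case_prod_conv image_eqI)
  have shift: "((u + k) mod n, (v + k) mod n) \<in> parcs G" if uv: "(u, v) \<in> parcs G" for u v k
  proof (induction k)
    case 0
    then show ?case using uv lt[OF uv] by simp
  next
    case (Suc k)
    from step[OF Suc] show ?case by (simp add: mod_simps)
  qed
  show "parcs G = cayley n (connection G)"
  proof (rule equalityI; rule subsetI)
    fix e assume e: "e \<in> parcs G"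
    obtain u v where uv: "e = (u, v)" by (cases e)
    have l: "u < n" "v < n" using lt e uv by auto
    obtain s where s: "s < n" "v = (u + s) mod n" using difference_exists l by blast
    have "((u + (n - u)) mod n, (v + (n - u)) mod n) \<in> parcs G"
      using shift e uv by blast
    moreover have "(v + (n - u)) mod n = (s + (u + (n - u))) mod n"
      unfolding s(2) by (simp only: mod_add_left_eq) (simp only: ac_simps)
    ultimately have "s \<in> connection G"
      using l s(1) by (simp add: connection_def)
    then show "e \<in> cayley n (connection G)"
      using uv l s by (auto simp: cayley_def)
  next
    fix e assume "e \<in> cayley n (connection G)"
    then obtain u s where us: "e = (u, (u + s) mod n)" "u < n" "(0, s) \<in> parcs G"
      by (auto simp: cayley_def connection_def)
    then show "e \<in> parcs G" using shift[OF us(3), of u] by (simp add: add.commute)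
  qed
qed

lemma connection_cayley_digraph:
  assumes "n > 0" "S \<subseteq> {1..<n}"
  shows "connection (cayley_digraph n S) = S"
  using assms by (force simp: connection_def cayley_digraph_def cayley_def)

lemma circulant_cayley_digraph:
  assumes n: "n > 0" and S: "S \<subseteq> {1..<n}"
  shows "circulant n (cayley_digraph n S)"
  unfolding circulant_def
proof (intro conjI)
  have sub: "cayley n S \<subseteq> {..<n} \<times> {..<n}" using n by (auto simp: cayley_def)
  have loop: "u \<noteq> v" if "(u, v) \<in> cayley n S" for u v
  proof
    assume "u = v"
    with that obtain s where s: "s \<in> S" "u < n" "u = (u + s) mod n" by (auto simp: cayley_def)
    have "s = 0" by (rule add_mod_cancel_left[of s n 0 u]) (use s S n in auto)
    with s(1) S show False by auto
  qed
  show "pair_digraph (cayley_digraph n S)"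
  proof
    show "finite (parcs (cayley_digraph n S))"
      using finite_subset[OF sub] by (simp add: cayley_digraph_def)
  qed (use sub loop in \<open>force simp: cayley_digraph_def\<close>)+
  show "pverts (cayley_digraph n S) = {..<n}" by (simp add: cayley_digraph_def)
  let ?f = "\<lambda>(u, v). ((u + 1) mod n, (v + 1) mod n)"
  have "?f ` cayley n S = cayley n S"
  proof (rule equalityI; rule subsetI)
    fix e assume "e \<in> ?f ` cayley n S"
    then obtain u s where "s \<in> S" "e = ((u + 1) mod n, ((u + s) mod n + 1) mod n)"
      by (auto simp: cayley_def)
    moreover have "((u + s) mod n + 1) mod n = ((u + 1) mod n + s) mod n"
      by (simp add: mod_simps)
    ultimately show "e \<in> cayley n S" using n by (auto simp: cayley_def)
  next
    fix e assume "e \<in> cayley n S"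
    then obtain u s where us: "s \<in> S" "u < n" "e = (u, (u + s) mod n)" by (auto simp: cayley_def)
    define w where "w = (u + (n - 1)) mod n"
    have "(w + 1) mod n = u" using us(2) n by (simp add: w_def mod_simps)
    moreover have "((w + s) mod n + 1) mod n = ((w + 1) mod n + s) mod n" by (simp add: mod_simps)
    ultimately have "e = ?f (w, (w + s) mod n)" using us(3) by simp
    moreover have "(w, (w + s) mod n) \<in> cayley n S" using us(1) n by (auto simp: cayley_def w_def)
    ultimately show "e \<in> ?f ` cayley n S" by (rule image_eqI)
  qed
  then show "?f ` parcs (cayley_digraph n S) = parcs (cayley_digraph n S)"
    by (simp add: cayley_digraph_def)
qed

lemma cayley_digraph_connection:
  assumes "n > 0" "circulant n G"
  shows "cayley_digraph n (connection G) = G"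
  using circulant_connection(2)[OF assms] assms(2)
  by (intro pair_pre_digraph.equality) (simp_all add: cayley_digraph_def circulant_def)

lemma has_valency_iff:
  assumes n: "n > 0" and G: "circulant n G"
  shows "has_valency G r \<longleftrightarrow> card (connection G) = r"
proof -
  define S where "S = connection G"
  have S: "S \<subseteq> {1..<n}" and P: "parcs G = cayley n S"
    unfolding S_def using circulant_connection[OF n G] .
  have Slt: "s < n" if "s \<in> S" for s using S that by auto
  have V: "pverts G = {..<n}" using G by (simp add: circulant_def)
  have out: "out_degree (with_proj G) v = card S" if v: "v < n" for v
  proof -
    have "out_arcs (with_proj G) v = (\<lambda>s. (v, (v + s) mod n)) ` S"
      using v by (auto simp: out_arcs_def P cayley_def)
    moreover have "inj_on (\<lambda>s. (v, (v + s) mod n)) S"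
      using add_mod_cancel_left[of _ n _ v] Slt by (intro inj_onI) auto
    ultimately show ?thesis by (simp add: out_degree_def card_image)
  qed
  have inn: "in_degree (with_proj G) v = card S" if v: "v < n" for v
  proof -
    have "in_arcs (with_proj G) v = (\<lambda>s. ((v + (n - s)) mod n, v)) ` S"
    proof (rule equalityI; rule subsetI)
      fix e assume "e \<in> in_arcs (with_proj G) v"
      then obtain u s where us: "e = (u, v)" "s \<in> S" "u < n" "v = (u + s) mod n"
        by (auto simp: in_arcs_def P cayley_def)
      have "(v + (n - s)) mod n = (u + (s + (n - s))) mod n"
        unfolding us(4) by (simp only: mod_add_left_eq add.assoc)
      also have "\<dots> = u" using us(3) Slt[OF us(2)] by simp
      finally have "(v + (n - s)) mod n = u" .
      then show "e \<in> (\<lambda>s. ((v + (n - s)) mod n, v)) ` S"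
        using us(1,2) by (intro image_eqI[of _ _ s]) simp_all
    next
      fix e assume "e \<in> (\<lambda>s. ((v + (n - s)) mod n, v)) ` S"
      then obtain s where s: "s \<in> S" "e = ((v + (n - s)) mod n, v)" by blast
      have "((v + (n - s)) mod n + s) mod n = (v + ((n - s) + s)) mod n"
        by (simp only: mod_add_left_eq add.assoc)
      also have "\<dots> = v" using v Slt[OF s(1)] by simp
      finally have "e = ((v + (n - s)) mod n, ((v + (n - s)) mod n + s) mod n)" using s(2) by simp
      then show "e \<in> in_arcs (with_proj G) v"
        using s n by (auto simp: in_arcs_def P cayley_def)
    qed
    moreover have "inj_on (\<lambda>s. ((v + (n - s)) mod n, v)) S"
    proof (rule inj_onI)
      fix s t assume st: "s \<in> S" "t \<in> S" "((v + (n - s)) mod n, v) = ((v + (n - t)) mod n, v)"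
      have "s > 0" "t > 0" using S st by auto
      then have "n - s = n - t"
        using st by (intro add_mod_cancel_left[of "n - s" n "n - t" v]) (use n in auto)
      then show "s = t" using Slt[OF st(1)] Slt[OF st(2)] by simp
    qed
    ultimately show ?thesis by (simp add: in_degree_def card_image)
  qed
  show ?thesis
    using out inn n by (auto simp: has_valency_def V S_def[symmetric])
qed

text \<open>
  The notion of isomorphism on the left allows an arbitrary relabelling of arcs; as arcs here are
  pairs with the projections as tail and head, it is forced to act through the vertices.
\<close>

lemma digraph_iso_iff_cayley_iso:
  assumes n: "n > 0" and G: "circulant n G" and H: "circulant n H"
  shows "digraph_iso (with_proj G) (with_proj H) \<longleftrightarrow>
    (\<exists>f. cayley_iso n (connection G) (connection H) f)"
proof
  have VG: "pverts G = {..<n}" and VH: "pverts H = {..<n}" using G H by (simp_all add: circulant_def)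
  have PG: "parcs G = cayley n (connection G)" and PH: "parcs H = cayley n (connection H)"
    using circulant_connection(2)[OF n] G H by blast+
  interpret G: pair_digraph G using G by (simp add: circulant_def)
  {
    assume "digraph_iso (with_proj G) (with_proj H)"
    then obtain h where h: "G.digraph_isomorphism h" "with_proj H = app_iso h (with_proj G)"
      by (auto simp: digraph_iso_def)
    define F where "F = (\<lambda>x. if x < n then iso_verts h x else x)"
    have inj: "inj_on (iso_verts h) {..<n}"
      using h(1) VG by (simp add: G.digraph_isomorphism_def)
    have img: "iso_verts h ` {..<n} = {..<n}"
      using arg_cong[OF h(2), of verts] VG VH by simp
    have arcs: "parcs H = iso_arcs h ` parcs G"
      using arg_cong[OF h(2), of arcs] by simp
    have tail: "iso_tail h = fst" and head: "iso_head h = snd"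
      using arg_cong[OF h(2), of tail] arg_cong[OF h(2), of head] by simp_all
    have ends: "iso_arcs h (u, v) = (iso_verts h u, iso_verts h v)" if "(u, v) \<in> parcs G" for u v
      using h(1) that unfolding G.digraph_isomorphism_def tail head
      by (auto simp: prod_eq_iff)
    have "F permutes {..<n}"
    proof (rule bij_imp_permutes)
      have "bij_betw (iso_verts h) {..<n} {..<n}" using inj img by (simp add: bij_betw_def)
      then show "bij_betw F {..<n} {..<n}" by (rule bij_betw_cong[THEN iffD1, rotated]) (simp add: F_def)
    qed (simp add: F_def)
    moreover have "(u, v) \<in> parcs G \<longleftrightarrow> (F u, F v) \<in> parcs H" if uv: "u < n" "v < n" for u v
    proof
      assume "(u, v) \<in> parcs G"
      then show "(F u, F v) \<in> parcs H"
        using ends uv unfolding arcs F_def by force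
    next
      assume "(F u, F v) \<in> parcs H"
      then obtain a b where ab: "(a, b) \<in> parcs G" "(F u, F v) = iso_arcs h (a, b)"
        unfolding arcs by auto
      have "a < n" "b < n" using G.in_arcsD1[OF ab(1)] G.in_arcsD2[OF ab(1)] VG by auto
      moreover have "iso_verts h u = iso_verts h a" "iso_verts h v = iso_verts h b"
        using ab ends[OF ab(1)] uv by (auto simp: F_def)
      ultimately have "u = a" "v = b" using inj uv by (auto dest: inj_onD)
      then show "(u, v) \<in> parcs G" using ab(1) by simp
    qed
    ultimately show "\<exists>f. cayley_iso n (connection G) (connection H) f"
      unfolding cayley_iso_def PG[symmetric] PH[symmetric] by blast
  next
    assume "\<exists>f. cayley_iso n (connection G) (connection H) f"
    then obtain f where fi: "cayley_iso n (connection G) (connection H) f" by (elim exE)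
    note f = cayley_iso_permutes[OF fi] cayley_isoD[OF fi, folded PG PH]
    interpret H: pair_digraph H using H by (simp add: circulant_def)
    define h :: "(nat, nat \<times> nat, nat, nat \<times> nat) digraph_isomorphism"
      where "h = \<lparr>iso_verts = f, iso_arcs = map_prod f f, iso_head = snd, iso_tail = fst\<rparr>"
    have inj: "inj f" using f(1) by (rule permutes_inj)
    have "G.digraph_isomorphism h"
      unfolding G.digraph_isomorphism_def
    proof (intro conjI)
      show "wf_digraph (with_proj G)" by (rule G.wf_digraph_axioms)
      show "inj_on (iso_verts h) (pverts G)"
        by (rule inj_on_subset[of _ UNIV]) (simp_all add: h_def inj)
      show "inj_on (iso_arcs h) (parcs G)"
        by (rule inj_on_subset[of _ UNIV]) (simp_all add: h_def prod.inj_map inj)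
    qed (auto simp: h_def)
    moreover have "with_proj H = app_iso h (with_proj G)"
    proof -
      have "parcs H = map_prod f f ` parcs G"
      proof (rule equalityI; rule subsetI)
        fix e assume e: "e \<in> parcs H"
        obtain u v where uv: "e = (u, v)" by (cases e)
        have "u \<in> {..<n}" "v \<in> {..<n}" using H.in_arcsD1 H.in_arcsD2 e uv VH by auto
        then obtain a b where "a < n" "b < n" "u = f a" "v = f b"
          using permutes_image[OF f(1)] by (metis imageE lessThan_iff)
        then show "e \<in> map_prod f f ` parcs G" using f(2) e uv by force
      next
        fix e assume "e \<in> map_prod f f ` parcs G"
        then obtain a b where ab: "(a, b) \<in> parcs G" "e = (f a, f b)" by auto
        have "a < n" "b < n" using G.in_arcsD1[OF ab(1)] G.in_arcsD2[OF ab(1)] VG by auto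
        then show "e \<in> parcs H" using f(2) ab by blast
      qed
      moreover have "pverts H = f ` pverts G" using VG VH permutes_image[OF f(1)] by simp
      ultimately show ?thesis by (simp add: with_proj_def app_iso_def h_def)
    qed
    ultimately show "digraph_iso (with_proj G) (with_proj H)"
      unfolding digraph_iso_def by blast
  }
qed

lemma cayley_iso_multiplier:
  assumes n: "n > 0" and u: "coprime u n" and S: "S \<subseteq> {..<n}"
  shows "\<exists>f. cayley_iso n S ((\<lambda>s. u * s mod n) ` S) f"
proof -
  define f where "f = (\<lambda>x. if x < n then u * x mod n else x)"
  have inj: "inj_on (\<lambda>s. u * s mod n) {..<n}" using u by (rule inj_on_mult_mod)
  have "inj_on f {..<n} \<longleftrightarrow> inj_on (\<lambda>s. u * s mod n) {..<n}"
    by (rule inj_on_cong) (simp add: f_def)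
  then have "inj_on f {..<n}" using inj by (rule iffD2)
  moreover have "f ` {..<n} \<subseteq> {..<n}" using n by (auto simp: f_def)
  ultimately have "bij_betw f {..<n} {..<n}" by (simp add: bij_betw_def endo_inj_surj)
  then have "f permutes {..<n}" by (rule bij_imp_permutes) (simp add: f_def)
  moreover have "(x, y) \<in> cayley n S \<longleftrightarrow> (f x, f y) \<in> cayley n ((\<lambda>s. u * s mod n) ` S)"
    if xy: "x < n" "y < n" for x y
  proof -
    obtain s where s: "s < n" "y = (x + s) mod n" using difference_exists xy by blast
    have fx: "f x < n" using n xy by (simp add: f_def)
    have fy: "f y = (f x + u * s mod n) mod n"
      using xy unfolding f_def s(2) by (simp add: mod_simps distrib_left)
    have T: "(\<lambda>s. u * s mod n) ` S \<subseteq> {..<n}" using n by auto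
    have "(f x, f y) \<in> cayley n ((\<lambda>s. u * s mod n) ` S) \<longleftrightarrow> u * s mod n \<in> (\<lambda>s. u * s mod n) ` S"
      unfolding fy using cayley_iff[OF T fx, of "u * s mod n"] n by simp
    also have "\<dots> \<longleftrightarrow> s \<in> S"
      using inj_on_image_mem_iff[OF inj _ S, of s] s(1) by simp
    also have "\<dots> \<longleftrightarrow> (x, y) \<in> cayley n S"
      unfolding s(2) using cayley_iff[OF S xy(1) s(1)] by simp
    finally show ?thesis by simp
  qed
  ultimately show ?thesis unfolding cayley_iso_def by blast
qed

text \<open>
  This transfers the count of isomorphism classes of digraphs to a count of orbits of connection
  sets.
\<close>

lemma card_quotient_orbits:
  assumes F: "bij_betw F A B" and closed: "\<And>b. b \<in> B \<Longrightarrow> h b \<in> B"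
    and R: "\<And>a a'. a \<in> A \<Longrightarrow> a' \<in> A \<Longrightarrow> (a, a') \<in> R \<longleftrightarrow> F a' \<in> cyclic_orbit h (F a)"
    and RA: "R \<subseteq> A \<times> A"
  shows "card (A // R) = card (cyclic_orbit h ` B)"
proof -
  define P where "P = (\<lambda>C. {a' \<in> A. F a' \<in> C})"
  have FA: "F ` A = B" using F by (simp add: bij_betw_def)
  have "R `` {a} = P (cyclic_orbit h (F a))" if "a \<in> A" for a
    using R[OF that] RA by (auto simp: P_def)
  then have "A // R = P ` cyclic_orbit h ` B"
    unfolding quotient_def FA[symmetric] by auto
  moreover have "inj_on P (cyclic_orbit h ` B)"
  proof (rule inj_onI)
    have FP: "F ` P C = C" if "C \<in> cyclic_orbit h ` B" for C
    proof -
      have "C \<subseteq> F ` A" using that cyclic_orbit_subset[of B h] closed unfolding FA by blast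
      then show ?thesis by (auto simp: P_def)
    qed
    fix C D assume "C \<in> cyclic_orbit h ` B" "D \<in> cyclic_orbit h ` B" "P C = P D"
    then show "C = D" using FP by metis
  qed
  ultimately show ?thesis by (simp add: card_image)
qed

context multiplier_generator
begin

lemma cayley_iso_iff_orbit:
  assumes S: "S \<subseteq> {1..<n}" and T: "T \<subseteq> {1..<n}"
  shows "(\<exists>f. cayley_iso n S T f) \<longleftrightarrow> T \<in> cyclic_orbit ((`) \<phi>) S"
proof -
  have Sn: "S \<subseteq> {..<n}" and Tn: "T \<subseteq> {..<n}" using S T by auto
  have pw: "((`) \<phi> ^^ i) S = (\<lambda>s. g ^ i * s mod n) ` S" for i
    unfolding image_funpow using Sn by (intro image_cong refl scale_funpow) auto
  show ?thesis
  proof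
    assume "\<exists>f. cayley_iso n S T f"
    then obtain f where f: "cayley_iso n S T f" by blast
    have "\<exists>u. coprime u n \<and> T = (\<lambda>s. u * s mod n) ` S"
    proof (cases "n = 2 * q")
      case True
      show ?thesis by (rule cayley_iso_imp_multiplier_double_prime[OF q True S T f])
    next
      case False
      then have "n = q" using n by simp
      then show ?thesis using cayley_iso_imp_multiplier_prime[of n S T f] q(1) Sn Tn f by simp
    qed
    then obtain u where u: "coprime u n" "T = (\<lambda>s. u * s mod n) ` S" by blast
    obtain i where i: "[u = g ^ i] (mod n)" using power_g_surj[OF u(1)] by blast
    have "u * s mod n = g ^ i * s mod n" for s
      using cong_mult[OF i cong_refl[of s]] by (simp add: cong_def)
    then have "T = ((`) \<phi> ^^ i) S" by (simp add: u(2) pw)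
    then show "T \<in> cyclic_orbit ((`) \<phi>) S" by (auto simp: cyclic_orbit_def)
  next
    assume "T \<in> cyclic_orbit ((`) \<phi>) S"
    then obtain i where "T = (\<lambda>s. g ^ i * s mod n) ` S" by (auto simp: cyclic_orbit_def pw)
    moreover have "coprime (g ^ i) n" using coprime_g_n by simp
    ultimately show "\<exists>f. cayley_iso n S T f" using cayley_iso_multiplier[OF n_pos _ Sn] by simp
  qed
qed

lemma invariant_sets_full: "invariant_sets (q - 1) = Pow {1..<n}"
proof -
  have "(\<phi> ^^ (q - 1)) x = x" if x: "x \<in> {1..<n}" for x
  proof (cases "x \<in> free_points")
    case True
    then show ?thesis using \<phi>_period[of x "q - 1"] by simp
  next
    case False
    have "n \<noteq> q"
    proof
      assume "n = q"
      then have "{1..<n} = free_points" using points_split by (metis (full_types))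
      with x False show False by blast
    qed
    then have "{1..<n} = insert q free_points" using points_split by (simp only: if_False)
    then have xq: "x = q" using x False by blast
    have "\<phi> q = q" by (rule \<phi>_q) (use n \<open>n \<noteq> q\<close> in blast)
    then have "(\<phi> ^^ k) q = q" for k by (induction k) simp_all
    then show ?thesis by (simp only: xq)
  qed
  then have "(\<phi> ^^ (q - 1)) ` A = A" if "A \<subseteq> {1..<n}" for A
    using that by (force simp: subset_iff)
  then show ?thesis by (auto simp: invariant_sets_def)
qed

text \<open>
  The power \<open>(q - 1) div 2\<close> of a generator is the unit \<open>-1\<close>.
\<close>

lemma invariant_sets_half:
  "invariant_sets ((q - 1) div 2) = {A. A \<subseteq> {1..<n} \<and> (\<forall>s\<in>A. n - s \<in> A)}"
proof -
  have neg: "(\<phi> ^^ ((q - 1) div 2)) s = n - s" if s: "s \<in> {1..<n}" for s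
  proof -
    have "[g ^ ((q - 1) div 2) * s = (n - 1) * s] (mod n)"
      by (rule cong_mult[OF power_g_half cong_refl])
    moreover have "(n - 1) * s = (n - s) + n * (s - 1)"
    proof -
      have "(n - 1) * s + s = n * s" using n_pos by (simp add: diff_mult_distrib)
      moreover have "n * (s - 1) + n = n * s" using s by (simp add: diff_mult_distrib2)
      ultimately show ?thesis using s by simp
    qed
    ultimately have "g ^ ((q - 1) div 2) * s mod n = (n - s) mod n"
      by (simp add: cong_def)
    then show ?thesis using s by (simp add: scale_funpow)
  qed
  have "(\<phi> ^^ ((q - 1) div 2)) ` A = A \<longleftrightarrow> (\<forall>s\<in>A. n - s \<in> A)" if A: "A \<subseteq> {1..<n}" for A
  proof -
    have im: "(\<phi> ^^ ((q - 1) div 2)) ` A = (\<lambda>s. n - s) ` A"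
      using neg A by (intro image_cong refl) auto
    have inv: "n - (n - s) = s" if "s \<in> A" for s using A that by auto
    show ?thesis unfolding im
    proof
      assume sym: "\<forall>s\<in>A. n - s \<in> A"
      show "(\<lambda>s. n - s) ` A = A"
      proof
        show "A \<subseteq> (\<lambda>s. n - s) ` A"
        proof
          fix s assume "s \<in> A"
          then show "s \<in> (\<lambda>s. n - s) ` A"
            using sym inv by (intro image_eqI[of s _ "n - s"]) simp_all
        qed
      qed (use sym in blast)
    qed blast
  qed
  then show ?thesis unfolding invariant_sets_def by blast
qed

lemma pair_graph_iff_symmetric:
  assumes G: "circulant n G"
  shows "pair_graph G \<longleftrightarrow> (\<forall>s\<in>connection G. n - s \<in> connection G)"
proof -
  interpret pair_digraph G using G by (simp add: circulant_def)
  define S where "S = connection G"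
  have S: "S \<subseteq> {1..<n}" and P: "parcs G = cayley n S"
    unfolding S_def using circulant_connection[OF n_pos G] .
  have Sn: "S \<subseteq> {..<n}" using S by auto
  have "pair_graph G \<longleftrightarrow> sym (parcs G)"
  proof
    assume "pair_graph G"
    then interpret pair_graph G .
    show "sym (parcs G)" using pair_sym_arcs by (simp add: symmetric_def)
  next
    assume "sym (parcs G)"
    then show "pair_graph G" by unfold_locales (simp add: symmetric_def)
  qed
  also have "\<dots> \<longleftrightarrow> (\<forall>s\<in>S. n - s \<in> S)"
  proof
    assume sym: "sym (parcs G)"
    show "\<forall>s\<in>S. n - s \<in> S"
    proof
      fix s assume s: "s \<in> S"
      then have sn: "s < n" "n - s < n" using S n_pos by auto
      have "(0, s) \<in> cayley n S" using cayley_iff[OF Sn n_pos sn(1)] s sn by simp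
      then have "(s, (s + (n - s)) mod n) \<in> cayley n S" using sym sn P by (auto dest: symD)
      then show "n - s \<in> S" using cayley_iff[OF Sn sn] by simp
    qed
  next
    assume neg: "\<forall>s\<in>S. n - s \<in> S"
    show "sym (parcs G)" unfolding P
    proof (rule symI)
      fix u v assume "(u, v) \<in> cayley n S"
      then obtain s where s: "u < n" "s \<in> S" "v = (u + s) mod n" by (auto simp: cayley_def)
      have sn: "s < n" using s(2) Sn by auto
      have vn: "v < n" using s(3) n_pos by simp
      have "(v + (n - s)) mod n = (u + (s + (n - s))) mod n"
        unfolding s(3) by (simp only: mod_add_left_eq add.assoc)
      also have "\<dots> = u" using s(1) sn by simp
      finally show "(v, u) \<in> cayley n S" using neg s(2) vn unfolding cayley_def by force
    qed
  qed
  finally show ?thesis by (simp add: S_def)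
qed

lemma bij_betw_connection:
  "bij_betw connection {G. circulant n G \<and> connection G \<in> \<A> \<and> has_valency G r}
    {A \<in> \<A>. A \<subseteq> {1..<n} \<and> card A = r}"
proof (rule bij_betwI[where g = "cayley_digraph n"])
  show "connection \<in> {G. circulant n G \<and> connection G \<in> \<A> \<and> has_valency G r} \<rightarrow>
      {A \<in> \<A>. A \<subseteq> {1..<n} \<and> card A = r}"
    using has_valency_iff[OF n_pos] circulant_connection(1)[OF n_pos] by blast
  show "cayley_digraph n \<in> {A \<in> \<A>. A \<subseteq> {1..<n} \<and> card A = r} \<rightarrow>
      {G. circulant n G \<and> connection G \<in> \<A> \<and> has_valency G r}"
    using has_valency_iff[OF n_pos circulant_cayley_digraph[OF n_pos]]
      circulant_cayley_digraph[OF n_pos] connection_cayley_digraph[OF n_pos] by auto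
qed (use cayley_digraph_connection[OF n_pos] connection_cayley_digraph[OF n_pos] in auto)

lemma card_iso_classes:
  assumes D: "D = {G. circulant n G \<and> connection G \<in> invariant_sets m \<and> has_valency G r}"
  shows "card (D // iso_rel D) =
    card (cyclic_orbit ((`) \<phi>) ` {A \<in> invariant_sets m. card A = r})"
proof (rule card_quotient_orbits)
  have "{A \<in> invariant_sets m. A \<subseteq> {1..<n} \<and> card A = r} = {A \<in> invariant_sets m. card A = r}"
    by (auto simp: invariant_sets_def)
  then show "bij_betw connection D {A \<in> invariant_sets m. card A = r}"
    using bij_betw_connection[of "invariant_sets m" r] by (simp only: D)
  show "\<phi> ` A \<in> {A \<in> invariant_sets m. card A = r}" if "A \<in> {A \<in> invariant_sets m. card A = r}" for A
    using invariant_sets_closed[of A m] that by simp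
  show "iso_rel D \<subseteq> D \<times> D" by (auto simp: iso_rel_def)
  fix G H assume GH: "G \<in> D" "H \<in> D"
  then have c: "circulant n G" "circulant n H" by (simp_all add: D)
  show "(G, H) \<in> iso_rel D \<longleftrightarrow> connection H \<in> cyclic_orbit ((`) \<phi>) (connection G)"
    using GH digraph_iso_iff_cayley_iso[OF n_pos c]
      cayley_iso_iff_orbit[OF circulant_connection(1)[OF n_pos c(1)] circulant_connection(1)[OF n_pos c(2)]]
    by (simp add: iso_rel_def)
qed

lemma Cd_val_eq_card_orbits:
  "Cd_val n r = card (cyclic_orbit ((`) \<phi>) ` {A \<in> invariant_sets (q - 1). card A = r})"
  unfolding Cd_val_def
proof (rule card_iso_classes)
  show "directed_circulants n r =
      {G. circulant n G \<and> connection G \<in> invariant_sets (q - 1) \<and> has_valency G r}"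
    using circulant_connection(1)[OF n_pos]
    unfolding directed_circulants_def invariant_sets_full by blast
qed

lemma Cu_val_eq_card_orbits:
  "Cu_val n r = card (cyclic_orbit ((`) \<phi>) ` {A \<in> invariant_sets ((q - 1) div 2). card A = r})"
  unfolding Cu_val_def
proof (rule card_iso_classes)
  show "undirected_circulants n r =
      {G. circulant n G \<and> connection G \<in> invariant_sets ((q - 1) div 2) \<and> has_valency G r}"
    using circulant_connection(1)[OF n_pos] pair_graph_iff_symmetric
    unfolding undirected_circulants_def invariant_sets_half by blast
qed

end

lemma monom_of_nat_eq: "monom (of_nat a) r = of_nat a * (monom 1 1 :: rat poly) ^ r"
  by (simp add: monom_altdef of_nat_poly)

theorem cd_poly_formula:
  assumes "multiplier_generator q n g"
  shows "of_nat (q - 1) * cd_poly n = multiplier_generator.fixed_point_factor q n (monom 1 1) *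
    (\<Sum>r | r dvd q - 1. of_nat (totient r) * (1 + monom 1 1 ^ r) ^ (n div q * ((q - 1) div r)))"
proof -
  interpret multiplier_generator q n g by (rule assms)
  show ?thesis
    using orbit_enumerator[of "q - 1" "monom 1 1"] q_gt_2
    by (simp add: cd_poly_def monom_of_nat_eq Cd_val_eq_card_orbits)
qed

theorem cu_poly_formula:
  assumes "multiplier_generator q n g"
  shows "of_nat ((q - 1) div 2) * cu_poly n = multiplier_generator.fixed_point_factor q n (monom 1 1) *
    (\<Sum>r | r dvd (q - 1) div 2. of_nat (totient r) *
      (1 + monom 1 1 ^ (2 * r)) ^ (n div q * ((q - 1) div 2 div r)))"
proof -
  interpret multiplier_generator q n g by (rule assms)
  have "even (q - 1)" using q(2) by simp
  then obtain j where j: "q - 1 = 2 * j" by blast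
  have "(q - 1) div 2 > 0" using q_gt_2 by simp
  moreover from this have "(q - 1) div 2 dvd q - 1" "(q - 1) div ((q - 1) div 2) = 2"
    unfolding j by simp_all
  ultimately show ?thesis
    using orbit_enumerator[of "(q - 1) div 2" "monom 1 1"]
    by (simp add: cu_poly_def monom_of_nat_eq Cu_val_eq_card_orbits)
qed

section \<open>The identities\<close>

text \<open>
  The divisors of \<open>2 * N\<close> are those of \<open>N\<close> and those with the full power of two, \<open>2 ^ (j + 1) * s\<close>
  with \<open>s\<close> dividing \<open>pt\<close>; the totient of the latter is \<open>2 ^ j * totient s\<close>.
\<close>

lemma sum_divisors_double:
  fixes F :: "nat \<Rightarrow> 'a :: comm_semiring_1"
  assumes pt: "pt > 0" "odd pt" and N: "N = 2 ^ j * pt"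
  shows "(\<Sum>r | r dvd 2 * N. of_nat (totient r) * F r) =
    (\<Sum>r | r dvd N. of_nat (totient r) * F r) +
    of_nat (2 ^ j) * (\<Sum>s | s dvd pt. of_nat (totient s) * F (2 ^ (j + 1) * s))"
proof -
  have N0: "N > 0" using pt N by simp
  have split: "{r. r dvd 2 * N} = {r. r dvd N} \<union> (\<lambda>s. 2 ^ (j + 1) * s) ` {s. s dvd pt}"
  proof (rule equalityI; rule subsetI)
    fix r assume "r \<in> {r. r dvd 2 * N}"
    then have "r dvd 2 ^ (j + 1) * pt" by (simp add: N mult.assoc)
    then obtain b c where bc: "r = b * c" "b dvd 2 ^ (j + 1)" "c dvd pt"
      using division_decomp[of r "2 ^ (j + 1)" pt] by auto
    then obtain i where i: "i \<le> j + 1" "b = 2 ^ i"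
      using divides_primepow_nat[of 2 b "j + 1"] by auto
    show "r \<in> {r. r dvd N} \<union> (\<lambda>s. 2 ^ (j + 1) * s) ` {s. s dvd pt}"
    proof (cases "i = j + 1")
      case True
      then show ?thesis using bc i by auto
    next
      case False
      then have "b dvd 2 ^ j" using i by (simp add: le_imp_power_dvd)
      then show ?thesis using bc N by (simp add: mult_dvd_mono)
    qed
  next
    fix r assume "r \<in> {r. r dvd N} \<union> (\<lambda>s. 2 ^ (j + 1) * s) ` {s. s dvd pt}"
    then show "r \<in> {r. r dvd 2 * N}" by (auto simp: N mult.assoc)
  qed
  have disj: "{r. r dvd N} \<inter> (\<lambda>s. 2 ^ (j + 1) * s) ` {s. s dvd pt} = {}"
  proof (rule ccontr)
    assume "{r. r dvd N} \<inter> (\<lambda>s. 2 ^ (j + 1) * s) ` {s. s dvd pt} \<noteq> {}"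
    then obtain s where "2 ^ (j + 1) * s dvd 2 ^ j * pt" using N by auto
    then have "2 ^ j * (2 * s) dvd 2 ^ j * pt" by (simp add: mult.assoc mult.left_commute)
    then have "2 * s dvd pt" by simp
    then show False using pt(2) by (auto dest: dvd_mult_left)
  qed
  have tot: "totient (2 ^ (j + 1) * s) = 2 ^ j * totient s" if "s dvd pt" for s
  proof -
    have "odd s" using that pt(2) dvd_trans by blast
    then have "coprime (2 ^ (j + 1)) s" by simp
    then have "totient (2 ^ (j + 1) * s) = totient (2 ^ (j + 1)) * totient s"
      by (rule totient_mult_coprime)
    also have "totient (2 ^ (j + 1)) = 2 ^ j"
      using totient_prime_power_Suc[of 2 j] by simp
    finally show ?thesis .
  qed
  have "(\<Sum>r | r dvd 2 * N. of_nat (totient r) * F r) =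
      (\<Sum>r | r dvd N. of_nat (totient r) * F r) +
      (\<Sum>r\<in>(\<lambda>s. 2 ^ (j + 1) * s) ` {s. s dvd pt}. of_nat (totient r) * F r)"
    unfolding split using N0 pt(1) disj by (intro sum.union_disjoint) auto
  also have "(\<Sum>r\<in>(\<lambda>s. 2 ^ (j + 1) * s) ` {s. s dvd pt}. of_nat (totient r) * F r) =
      (\<Sum>s | s dvd pt. of_nat (totient (2 ^ (j + 1) * s)) * F (2 ^ (j + 1) * s))"
    by (subst sum.reindex) (auto simp: inj_on_def)
  also have "\<dots> = (\<Sum>s | s dvd pt. of_nat (2 ^ j) * (of_nat (totient s) * F (2 ^ (j + 1) * s)))"
    by (rule sum.cong[OF refl]) (simp only: mem_Collect_eq tot of_nat_mult mult.assoc)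
  finally show ?thesis by (simp only: sum_distrib_left)
qed

text \<open>
  Common core of the directed and the undirected identity: \<open>P\<close> and \<open>Q\<close> are the enumerators for \<open>p\<close>
  and \<open>p + 1\<close>, and \<open>E\<close> is the factor \<open>1 + z\<close>.
\<close>

lemma double_enumerator_identity:
  fixes P Q D :: "rat poly"
  assumes pt: "pt > 0" "odd pt" and N: "N = 2 ^ j * pt"
    and P: "of_nat (2 * N) * P = (\<Sum>r | r dvd 2 * N. of_nat (totient r) * F r)"
    and Q: "of_nat N * Q = E * (\<Sum>r | r dvd N. of_nat (totient r) * F r)"
    and D: "of_nat pt * D = (\<Sum>s | s dvd pt. of_nat (totient s) * F (2 ^ (j + 1) * s))"
  shows "2 * P * E = Q + E * D"
proof -
  have "of_nat N * (2 * P * E) = E * (of_nat (2 * N) * P)"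
    by (simp add: algebra_simps)
  also have "\<dots> = E * (\<Sum>r | r dvd N. of_nat (totient r) * F r) + E * (of_nat (2 ^ j) * (of_nat pt * D))"
    unfolding P sum_divisors_double[OF pt N] D by (simp only: distrib_left)
  also have "\<dots> = of_nat N * Q + E * (of_nat (2 ^ j) * (of_nat pt * D))"
    by (simp only: Q)
  also have "\<dots> = of_nat N * (Q + E * D)"
    by (simp add: N algebra_simps)
  finally show ?thesis using N pt(1) by simp
qed

lemma pcompose_power: "pcompose (x ^ i) y = pcompose x y ^ i" for x y :: "'a :: comm_semiring_1 poly"
  by (induction i) (simp_all add: pcompose_mult pcompose_1)

lemma pcompose_monom_1: "pcompose (monom 1 1) (monom 1 K) = (monom 1 1 ^ K :: rat poly)"
  by (simp add: monom_altdef pcompose_pCons)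

lemma pcompose_enumerator:
  fixes X :: "rat poly"
  assumes "of_nat m * X = (\<Sum>s | s dvd m. of_nat (totient s) * (1 + monom 1 1 ^ (2 * s)) ^ (m div s))"
  shows "of_nat m * pcompose X (monom 1 K) =
    (\<Sum>s | s dvd m. of_nat (totient s) * (1 + monom 1 1 ^ (K * (2 * s))) ^ (m div s))"
proof -
  have nat: "pcompose (of_nat a) y = of_nat a" for a and y :: "rat poly"
    by (simp add: of_nat_poly)
  have "of_nat m * pcompose X (monom 1 K) = pcompose (of_nat m * X) (monom 1 K)"
    by (simp only: pcompose_mult nat)
  then show ?thesis
    by (simp only: assms pcompose_sum pcompose_mult nat pcompose_power pcompose_add pcompose_1
        pcompose_monom_1 power_mult)
qed

text \<open>
  The two cases in the definition of \<open>cu_bar_poly\<close> agree formally: for a prime \<open>2 * pt + 1\<close> the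
  enumerator of undirected circulants is given by the same cycle index.
\<close>

lemma cu_bar_formula:
  assumes pt: "pt > 0" "odd pt"
  shows "of_nat pt * cu_bar_poly (2 * pt + 1) =
    (\<Sum>s | s dvd pt. of_nat (totient s) * (1 + monom 1 1 ^ (2 * s)) ^ (pt div s))"
proof (cases "prime (2 * pt + 1)")
  case True
  obtain g where g: "multiplier_generator (2 * pt + 1) (2 * pt + 1) g"
    using multiplier_generator_exists[OF True, of "2 * pt + 1"] by auto
  have "multiplier_generator.fixed_point_factor (2 * pt + 1) (2 * pt + 1) w = 1" for w
    by (simp only: multiplier_generator.fixed_point_factor_def[OF g] refl if_True)
  then show ?thesis using cu_poly_formula[OF g] True by (simp add: cu_bar_poly_def)
next
  case False
  have "of_nat pt * smult (1 / of_nat pt) Y = Y" for Y :: "rat poly"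
    using pt(1) by (simp add: of_nat_poly)
  then show ?thesis
    using False by (simp add: cu_bar_poly_def cycle_index_cyclic_def monom_altdef)
qed

lemma poly_cd_poly_1: "poly (cd_poly n) 1 = of_nat (Cd n)"
  by (simp add: cd_poly_def Cd_def poly_sum poly_monom)

lemma poly_cu_poly_1: "poly (cu_poly n) 1 = of_nat (Cu n)"
  by (simp add: cu_poly_def Cu_def poly_sum poly_monom)

lemma one_plus_monom: "1 + monom 1 1 = ([:1, 1:] :: rat poly)"
  by (simp add: monom_altdef one_pCons)

lemma identity_at_1:
  fixes P Q X :: "rat poly"
  assumes "2 * P * [:1, 1:] = Q + [:1, 1:] * pcompose X (monom 1 K)"
  shows "4 * poly P 1 = poly Q 1 + 2 * poly X 1"
  using arg_cong[OF assms, of "\<lambda>p. poly p 1"] by (simp add: poly_pcompose poly_monom)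

lemma identity_as_fraction:
  fixes P Q D :: "rat poly"
  assumes "2 * P * [:1, 1:] = Q + [:1, 1:] * D"
  shows "to_fract (2 * P) = to_fract Q / to_fract [:1, 1:] + to_fract D"
proof -
  have nz: "to_fract [:1, 1 :: rat:] \<noteq> 0" by simp
  have "to_fract (2 * P) * to_fract [:1, 1:] = to_fract Q + to_fract [:1, 1:] * to_fract D"
    using arg_cong[OF assms, of to_fract] by (simp only: to_fract_mult to_fract_add)
  then show ?thesis using nz by (simp add: field_simps)
qed

theorem mainTheorem2:
  fixes p q pt k :: nat
  assumes "prime p" and "odd p"
    and "q = (p + 1) div 2" and "prime q" and "odd q"
    and "pt = Max {d. d dvd p - 1 \<and> odd d}"
    and "p - 1 = 2 ^ (k + 1) * pt"
  shows "4 * of_nat (Cu p) = of_nat (Cu (p + 1)) + 2 * Cu_bar (2 * pt + 1)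
    \<and> to_fract (2 * cu_poly p) =
        to_fract (cu_poly (p + 1)) / to_fract [:1, 1:]
        + to_fract (pcompose (cu_bar_poly (2 * pt + 1)) (monom 1 (2 ^ k)))
    \<and> 4 * of_nat (Cd p) = of_nat (Cd (p + 1)) + 2 * Cu_bar (2 * pt + 1)
    \<and> to_fract (2 * cd_poly p) =
        to_fract (cd_poly (p + 1)) / to_fract [:1, 1:]
        + to_fract (pcompose (cu_bar_poly (2 * pt + 1)) (monom 1 (2 ^ k)))"
proof -
  define w where "w = (monom 1 1 :: rat poly)"
  define D where "D = pcompose (cu_bar_poly (2 * pt + 1)) (monom 1 (2 ^ k))"
  have p1: "p > 1" using prime_gt_1_nat[OF assms(1)] .
  have pq: "p + 1 = 2 * q" "p - 1 = 2 * (q - 1)" using assms(2,3) by (auto elim!: oddE)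
  have q1: "q > 1" using prime_gt_1_nat[OF assms(4)] .
  have "{d. d dvd p - 1 \<and> odd d} \<noteq> {}" by (auto intro: exI[of _ 1])
  moreover have "finite {d. d dvd p - 1 \<and> odd d}" using p1 by simp
  ultimately have "pt \<in> {d. d dvd p - 1 \<and> odd d}" unfolding assms(6) by (rule Max_in[rotated])
  then have pt: "pt > 0" "odd pt" using p1 by (auto intro: Nat.gr0I)
  have qpt: "q - 1 = 2 ^ k * pt" using assms(7) pq(2) by simp
  \<comment> \<open>As \<open>q\<close> is odd, \<open>(q - 1) div 2\<close> has the power of two \<open>2 ^ (k - 1)\<close>, which the undirected case uses.\<close>
  have "k \<noteq> 0"
  proof
    assume "k = 0"
    then have "odd (q - 1)" using qpt pt(2) by simp
    then show False using assms(5) q1 by simp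
  qed
  then obtain j where k: "k = Suc j" by (cases k) auto
  have half: "(q - 1) div 2 = 2 ^ j * pt" using qpt k by simp
  obtain gp where gp: "multiplier_generator p p gp"
    using multiplier_generator_exists[OF assms(1,2), of p] by auto
  obtain gq where gq: "multiplier_generator q (2 * q) gq"
    using multiplier_generator_exists[OF assms(4,5), of "2 * q"] by auto
  have factor_p: "multiplier_generator.fixed_point_factor p p w = 1"
    using p1 by (simp add: multiplier_generator.fixed_point_factor_def[OF gp])
  have factor_q: "multiplier_generator.fixed_point_factor q (2 * q) w = 1 + w"
    using q1 by (simp add: multiplier_generator.fixed_point_factor_def[OF gq])
  have D: "of_nat pt * D =
      (\<Sum>s | s dvd pt. of_nat (totient s) * (1 + w ^ (2 ^ (k + 1) * s)) ^ (pt div s))"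
    unfolding D_def w_def using pcompose_enumerator[OF cu_bar_formula[OF pt], of "2 ^ k"]
    by (simp add: mult.assoc mult.left_commute)
  have quot: "2 * (N div r) = 2 * N div r" if "r dvd N" for r N :: nat
    using that by (rule div_mult_swap)

  have directed: "2 * cd_poly p * (1 + w) = cd_poly (p + 1) + (1 + w) * D"
  proof (rule double_enumerator_identity[OF pt qpt, where F = "\<lambda>r. (1 + w ^ r) ^ (2 * (q - 1) div r)"])
    show "of_nat (2 * (q - 1)) * cd_poly p =
        (\<Sum>r | r dvd 2 * (q - 1). of_nat (totient r) * (1 + w ^ r) ^ (2 * (q - 1) div r))"
      using cd_poly_formula[OF gp, folded w_def, unfolded factor_p pq(2)] p1 by simp
    show "of_nat (q - 1) * cd_poly (p + 1) = (1 + w) *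
        (\<Sum>r | r dvd q - 1. of_nat (totient r) * (1 + w ^ r) ^ (2 * (q - 1) div r))"
      unfolding pq(1)
      using cd_poly_formula[OF gq, folded w_def, unfolded factor_q] q1 by (simp add: quot)
    have "2 * (q - 1) div (2 ^ (k + 1) * s) = pt div s" if "s dvd pt" for s
    proof -
      have "2 * (q - 1) = 2 ^ (k + 1) * pt" using qpt by simp
      then have "2 * (q - 1) div (2 ^ (k + 1) * s) = 2 ^ (k + 1) * pt div (2 ^ (k + 1) * s)"
        by (simp only:)
      also have "\<dots> = pt div s" by (rule div_mult_mult1) simp
      finally show ?thesis .
    qed
    then show "of_nat pt * D = (\<Sum>s | s dvd pt. of_nat (totient s) *
        (1 + w ^ (2 ^ (k + 1) * s)) ^ (2 * (q - 1) div (2 ^ (k + 1) * s)))"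
      unfolding D by (intro sum.cong) auto
  qed

  have dbl: "2 * ((q - 1) div 2) = q - 1" using half qpt k by simp
  have undirected: "2 * cu_poly p * (1 + w) = cu_poly (p + 1) + (1 + w) * D"
  proof (rule double_enumerator_identity[OF pt half,
        where F = "\<lambda>r. (1 + w ^ (2 * r)) ^ (2 * ((q - 1) div 2) div r)"])
    have "(p - 1) div 2 = 2 * ((q - 1) div 2)" using pq(2) dbl by simp
    then show "of_nat (2 * ((q - 1) div 2)) * cu_poly p =
        (\<Sum>r | r dvd 2 * ((q - 1) div 2). of_nat (totient r) *
          (1 + w ^ (2 * r)) ^ (2 * ((q - 1) div 2) div r))"
      using cu_poly_formula[OF gp, folded w_def, unfolded factor_p] p1 by simp
    show "of_nat ((q - 1) div 2) * cu_poly (p + 1) = (1 + w) *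
        (\<Sum>r | r dvd (q - 1) div 2. of_nat (totient r) *
          (1 + w ^ (2 * r)) ^ (2 * ((q - 1) div 2) div r))"
      unfolding pq(1)
      using cu_poly_formula[OF gq, folded w_def, unfolded factor_q] q1 by (simp add: quot)
    have "2 * ((q - 1) div 2) div (2 ^ (j + 1) * s) = pt div s" if "s dvd pt" for s
    proof -
      have "2 * ((q - 1) div 2) = 2 ^ (j + 1) * pt" using half by simp
      then have "2 * ((q - 1) div 2) div (2 ^ (j + 1) * s) = 2 ^ (j + 1) * pt div (2 ^ (j + 1) * s)"
        by (simp only:)
      also have "\<dots> = pt div s" by (rule div_mult_mult1) simp
      finally show ?thesis .
    qed
    then show "of_nat pt * D = (\<Sum>s | s dvd pt. of_nat (totient s) *
        (1 + w ^ (2 * (2 ^ (j + 1) * s))) ^ (2 * ((q - 1) div 2) div (2 ^ (j + 1) * s)))"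
      unfolding D k by (intro sum.cong) (auto simp: mult.assoc)
  qed

  note eqs = directed[unfolded w_def one_plus_monom] undirected[unfolded w_def one_plus_monom]
  show ?thesis
    using identity_as_fraction[OF eqs(1)] identity_as_fraction[OF eqs(2)]
      identity_at_1[OF eqs(1)[unfolded D_def]] identity_at_1[OF eqs(2)[unfolded D_def]]
    by (simp only: poly_cd_poly_1 poly_cu_poly_1 Cu_bar_def D_def simp_thms)
qed

end
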